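(* Let $f_{11}(p_A,p_B)$ be the first-serving team's advantage in a game to $n=11$ of pickleball doubles with conventional side-out scoring (defined in the context). The function $x\mapsto f_{11}(x,x)$ has exactly five zeros $x_1<x_2<x_3<x_4<x_5$ in $(0,1)$, which when rounded to six decimal places are $$0.073510,\ 0.332744,\ 0.543030,\ 0.723066,\ 0.883588.$$ Moreover $f_{11}(x,x)$ is negative for $x$ in $(0,x_1)$, $(x_2,x_3)$, and $(x_4,x_5)$, and positive for $x$ in $(x_1,x_2)$, $(x_3,x_4)$, and $(x_5,1)$. Furthermore $f_{11}(p_A,p_B)<0$ for all $(p_A,p_B)\in(x_2,x_3)\times(x_2,x_3)$; that is, the first-serving team has a disadvantage there.
   Context: Side-out scoring chain for a game to $n$ (here $n=11$). Let $p_A$ (resp., $p_B$) be the probability that Team $A$ (resp., Team $B$) wins a rally when serving, with rallies independent and $p_A+p_B>0$. Put $q_A:=1-p_A$, $q_B:=1-p_B$. The score set is $\Sigma_n=(\{0,1,\ldots,n-1\}\times\{0,1,\ldots,n-1\})\cup\{(n-1,n),(n,n-1)\}$. The state space consists of the $4n^2+8$ states $(i,j,k)$ with $(i,j)\in\Sigma_n$ and $k\in\{1,2,3,4\}$, together with two absorbing states, "Team $A$ wins" and "Team $B$ wins". In state $(i,j,k)$, Team $A$ has $i$ points, Team $B$ has $j$ points, and $k$ says that the server is Team $A$'s first server ($k=1$), Team $A$'s second server ($k=2$), Team $B$'s first server ($k=3$), or Team $B$'s second server ($k=4$). Effect of a point for Team $A$ at score $(i,j)$: if $i\le n-2$, the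 score becomes $(i+1,j)$; if $i=n-1$ and $j\le n-2$, Team $A$ wins; $(n-1,n-1)$ becomes $(n,n-1)$; $(n-1,n)$ becomes $(n-1,n-1)$; at $(n,n-1)$ Team $A$ wins. Effect of a point for Team $B$ at score $(i,j)$: if $j\le n-2$, the score becomes $(i,j+1)$; if $j=n-1$ and $i\le n-2$, Team $B$ wins; $(n-1,n-1)$ becomes $(n-1,n)$; $(n,n-1)$ becomes $(n-1,n-1)$; at $(n-1,n)$ Team $B$ wins. Transitions (one step is one rally): from $(i,j,k)$ with $k\in\{1,2\}$, with probability $p_A$ Team $A$ gets a point and $k$ is unchanged (unless the game ends), and with probability $q_A$ the score is unchanged and $k$ becomes $k+1$. From $(i,j,k)$ with $k\in\{3,4\}$, with probability $p_B$ Team $B$ gets a point and $k$ is unchanged (unless the game ends), and with probability $q_B$ the score is unchanged and $k$ becomes $4$ if $k=3$, and $1$ if $k=4$. The initial state is $(0,0,2)$ if Team $A$ serves first and $(0,0,4)$ if Team $B$ serves first. The first-serving team's advantage is $$f_n(p_A,p_B):=\mathrm{P}(\text{Team } A \text{ wins game to } n\mid \text{Team } A \text{ serves first})-\mathrm{P}(\text{Team } A \text{ wins game to } n\mid \text{Team } B \text{ serves first}),$$ where "Team $A$ wins game to $n$" is the event of absorption at "Team $A$ wins". *)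

theory Defs
  imports "HOL-Probability.Probability"
begin

datatype server = FirstA | SecondA | FirstB | SecondB

datatype state = Rally nat nat server | WinA | WinB

definition score_set :: "nat \<Rightarrow> (nat \<times> nat) set" where
  "score_set n = {0..<n} \<times> {0..<n} \<union> {(n - 1, n), (n, n - 1)}"

definition state_space :: "nat \<Rightarrow> state set" where
  "state_space n = {Rally i j k | i j k. (i, j) \<in> score_set n} \<union> {WinA, WinB}"

(* The last branch of each function is meant for (n, n - 1), respectively (n - 1, n); scores
   outside score_set n also end up there, but are never reached (see step_in_state_space). *)

definition point_A :: "nat \<Rightarrow> nat \<Rightarrow> nat \<Rightarrow> server \<Rightarrow> state" where
  "point_A n i j k =
    (if i + 2 \<le> n then Rally (i + 1) j k
     else if i = n - 1 \<and> j + 2 \<le> n then WinA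
     else if (i, j) = (n - 1, n - 1) then Rally n (n - 1) k
     else if (i, j) = (n - 1, n) then Rally (n - 1) (n - 1) k
     else WinA)"

definition point_B :: "nat \<Rightarrow> nat \<Rightarrow> nat \<Rightarrow> server \<Rightarrow> state" where
  "point_B n i j k =
    (if j + 2 \<le> n then Rally i (j + 1) k
     else if j = n - 1 \<and> i + 2 \<le> n then WinB
     else if (i, j) = (n - 1, n - 1) then Rally (n - 1) n k
     else if (i, j) = (n, n - 1) then Rally (n - 1) (n - 1) k
     else WinB)"

fun next_server :: "server \<Rightarrow> server" where
  "next_server FirstA = SecondA"
| "next_server SecondA = FirstB"
| "next_server FirstB = SecondB"
| "next_server SecondB = FirstA"

(* bernoulli_pmf clamps its argument to [0, 1]; only pA and pB in [0, 1] are meaningful. *)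

fun step :: "nat \<Rightarrow> real \<Rightarrow> real \<Rightarrow> state \<Rightarrow> state pmf" where
  "step n pA pB (Rally i j k) =
    (if k \<in> {FirstA, SecondA}
     then map_pmf (\<lambda>won. if won then point_A n i j k else Rally i j (next_server k))
            (bernoulli_pmf pA)
     else map_pmf (\<lambda>won. if won then point_B n i j k else Rally i j (next_server k))
            (bernoulli_pmf pB))"
| "step n pA pB WinA = return_pmf WinA"
| "step n pA pB WinB = return_pmf WinB"

lemma step_in_state_space:
  assumes "n \<ge> 1" "s \<in> state_space n"
  shows "set_pmf (step n pA pB s) \<subseteq> state_space n"
  using assms
  by (cases s) (auto simp: state_space_def score_set_def point_A_def point_B_def split: if_splits)

(* The law of the chain started in s0, as a measure on trajectories nat => state, is the
   Ionescu-Tulcea limit of the kernels giving the state at time t from the earlier states. *)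

definition chain_kernel :: "nat \<Rightarrow> real \<Rightarrow> real \<Rightarrow> state \<Rightarrow> nat \<Rightarrow> (nat \<Rightarrow> state) \<Rightarrow> state measure" where
  "chain_kernel n pA pB s0 t \<omega> =
    measure_pmf (case t of 0 \<Rightarrow> return_pmf s0 | Suc u \<Rightarrow> step n pA pB (\<omega> u))"

lemma Ionescu_Tulcea_chain_kernel:
  "Ionescu_Tulcea (chain_kernel n pA pB s0) (\<lambda>_. count_space UNIV)"
proof (rule Ionescu_Tulcea.intro)
  fix t
  show "chain_kernel n pA pB s0 t \<in>
      measurable (PiM {0..<t} (\<lambda>_. count_space UNIV)) (subprob_algebra (count_space UNIV))"
  proof (cases t)
    case 0
    then show ?thesis
      by (simp add: chain_kernel_def[abs_def] measurable_const measure_pmf_in_subprob_algebra)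
  next
    case (Suc u)
    have "(\<lambda>s. measure_pmf (step n pA pB s)) \<in>
        measurable (count_space UNIV) (subprob_algebra (count_space UNIV))"
      by (simp add: measure_pmf_in_subprob_algebra)
    moreover have "(\<lambda>\<omega>. \<omega> u) \<in> measurable (PiM {0..<t} (\<lambda>_. count_space UNIV)) (count_space UNIV)"
      using Suc by (intro measurable_component_singleton) auto
    ultimately show ?thesis
      using Suc by (auto simp: chain_kernel_def[abs_def] intro: measurable_compose)
  qed
next
  fix t \<omega>
  show "prob_space (chain_kernel n pA pB s0 t \<omega>)"
    by (simp add: chain_kernel_def measure_pmf.prob_space_axioms)
qed

definition game_law :: "nat \<Rightarrow> real \<Rightarrow> real \<Rightarrow> state \<Rightarrow> (nat \<Rightarrow> state) measure" where
  "game_law n pA pB s0 =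
    projective_family.lim UNIV
      (Ionescu_Tulcea.CI (chain_kernel n pA pB s0) (\<lambda>_. count_space UNIV)) (\<lambda>_. count_space UNIV)"

definition prob_A_wins :: "nat \<Rightarrow> real \<Rightarrow> real \<Rightarrow> state \<Rightarrow> real" where
  "prob_A_wins n pA pB s0 =
    measure (game_law n pA pB s0)
      {\<omega> \<in> space (game_law n pA pB s0). \<exists>t. \<omega> t = WinA}"

definition advantage :: "nat \<Rightarrow> real \<Rightarrow> real \<Rightarrow> real" where
  "advantage n pA pB =
    prob_A_wins n pA pB (Rally 0 0 SecondA) - prob_A_wins n pA pB (Rally 0 0 SecondB)"

definition round_dec :: "nat \<Rightarrow> real \<Rightarrow> real" where
  "round_dec d x = of_int (round (10 ^ d * x)) / 10 ^ d"

lemma sets_game_law: "sets (game_law n pA pB s0) = sets (PiM UNIV (\<lambda>_. count_space UNIV))"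
proof -
  interpret Ionescu_Tulcea "chain_kernel n pA pB s0" "\<lambda>_. count_space UNIV"
    by (rule Ionescu_Tulcea_chain_kernel)
  show ?thesis by (simp add: game_law_def PF.sets_lim)
qed

lemma A_wins_event_measurable:
  "{\<omega> \<in> space (game_law n pA pB s0). \<exists>t. \<omega> t = WinA} \<in> sets (game_law n pA pB s0)"
proof -
  have [measurable]: "(\<lambda>\<omega>. \<omega> t) \<in> measurable (game_law n pA pB s0) (count_space UNIV)" for t
    by (subst measurable_cong_sets[OF sets_game_law refl])
       (rule measurable_component_singleton, simp)
  show ?thesis by measurable
qed

lemma game_law_cylinder:
  assumes "A \<in> sets (PiM {0..<t} (\<lambda>_. count_space UNIV))"
  shows "emeasure (game_law n pA pB s0) (prod_emb UNIV (\<lambda>_. count_space UNIV) {0..<t} A) =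
    emeasure (Ionescu_Tulcea.C (chain_kernel n pA pB s0) (\<lambda>_. count_space UNIV) 0 t (\<lambda>_. undefined)) A"
proof -
  interpret Ionescu_Tulcea "chain_kernel n pA pB s0" "\<lambda>_. count_space UNIV"
    by (rule Ionescu_Tulcea_chain_kernel)
  have "prod_emb {0..<t} (\<lambda>_. count_space UNIV) {0..<t} A = A"
    using assms sets.sets_into_space[OF assms] by (intro prod_emb_id) (auto simp: space_PiM)
  then show ?thesis
    using lim[OF _ assms] emeasure_CI[OF order_refl assms] by (simp add: game_law_def)
qed

end

theory Submission
  imports Defs
begin

text \<open>
  Write \<open>A = 1 - pA\<close>, \<open>B = 1 - pB\<close> and \<open>y = A * B\<close>. Changing the team that serves first shifts the numbers
  of servers used up by the two teams against each other by one, so in the difference of the two winning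
  probabilities the number of lost rallies enters with alternating signs, and the series over it are in
  powers of \<open>-y\<close>. Together with the solution of the deuce equations, the advantage in a game to \<open>n\<close> is
  a positive factor times \<open>pA pB P(y) + N Q(y)\<close>, where \<open>P(y) = \<Sum>k. (n-1 choose k)\<^sup>2 (-y)^k\<close>,
  \<open>Q(y) = \<Sum>k. (n-1 choose k) (n-2 choose k) (-y)^k\<close> and \<open>N = (A + B) (1 - y) + 2 y (1 + y)\<close>.

  For \<open>n = 11\<close> and \<open>A = B\<close> this is a polynomial of degree 22, whose signs are certified by positivity of
  transformed coefficients. On the square, \<open>N / (pA pB)\<close> increases away from the diagonal along
  \<open>y = const\<close>; where \<open>Q(y) \<le> 0\<close> this bounds the advantage by its sign on the diagonal. The remaining
  region \<open>Q(y) > 0\<close> is a small neighbourhood of the corner \<open>(x3, x3)\<close>, in which \<open>Q\<close> is so steep that the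
  monotonicity of \<open>Q\<close> alone decides.\<close>

section \<open>First-step equations\<close>

fun law :: "nat \<Rightarrow> real \<Rightarrow> real \<Rightarrow> nat \<Rightarrow> state \<Rightarrow> state pmf" where
  "law n pA pB 0 s = return_pmf s"
| "law n pA pB (Suc t) s = bind_pmf (law n pA pB t s) (step n pA pB)"

text \<open>\<open>law\<close> appends the newest step, as the trajectory measure does; conditioning
  on the first rally needs the step in front. Associativity of bind moves it there.\<close>

lemma law_Suc_first: "law n pA pB (Suc t) s = bind_pmf (step n pA pB s) (law n pA pB t)"
proof (induction t)
  case 0
  then show ?case by (simp add: bind_return_pmf bind_return_pmf')
next
  case (Suc t)
  have "law n pA pB (Suc (Suc t)) s = bind_pmf (law n pA pB (Suc t) s) (step n pA pB)"
    by simp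
  also have "\<dots> = bind_pmf (step n pA pB s) (law n pA pB (Suc t))"
    unfolding Suc.IH bind_assoc_pmf by (intro bind_pmf_cong) auto
  finally show ?case .
qed

section \<open>Finite prefixes of trajectories and the winning event\<close>

abbreviation prefix_law :: "nat \<Rightarrow> real \<Rightarrow> real \<Rightarrow> state \<Rightarrow> nat \<Rightarrow> (nat \<Rightarrow> state) measure" where
  "prefix_law n pA pB s0 t \<equiv>
    Ionescu_Tulcea.C (chain_kernel n pA pB s0) (\<lambda>_. count_space UNIV) 0 t (\<lambda>_. undefined)"

lemma nn_integral_prefix_law_Suc:
  assumes "f \<in> borel_measurable (PiM {0..<Suc t} (\<lambda>_. count_space UNIV))"
  shows "(\<integral>\<^sup>+\<omega>. f \<omega> \<partial>prefix_law n pA pB s0 (Suc t)) =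
    (\<integral>\<^sup>+\<omega>. \<integral>\<^sup>+s. f (fun_upd \<omega> t s) \<partial>chain_kernel n pA pB s0 t \<omega> \<partial>prefix_law n pA pB s0 t)"
proof -
  interpret Ionescu_Tulcea "chain_kernel n pA pB s0" "\<lambda>_. count_space UNIV"
    by (rule Ionescu_Tulcea_chain_kernel)
  have u: "(\<lambda>_. undefined) \<in> space (PiM {0..<0} (\<lambda>_. count_space UNIV))"
    by (auto simp: space_PiM PiE_iff extensional_def)
  have "(\<integral>\<^sup>+\<omega>. f \<omega> \<partial>C 0 (Suc t) (\<lambda>_. undefined)) =
      (\<integral>\<^sup>+\<omega>. \<integral>\<^sup>+x. f x \<partial>eP t \<omega> \<partial>C 0 t (\<lambda>_. undefined))"
    using assms u measurable_eP[of t] space_C[OF u, of t]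
    by (simp add: nn_integral_bind[where B="PiM {0..<Suc t} (\<lambda>_. count_space UNIV)"]
        measurable_cong_sets[OF sets_C[OF u] refl])
  also have "\<dots> = (\<integral>\<^sup>+\<omega>. \<integral>\<^sup>+s. f (fun_upd \<omega> t s) \<partial>chain_kernel n pA pB s0 t \<omega> \<partial>C 0 t (\<lambda>_. undefined))"
    using assms space_C[OF u, of t] by (intro nn_integral_cong nn_integral_eP) auto
  finally show ?thesis .
qed

lemma measurable_prefix_component:
  fixes i t :: nat
  shows "i < t \<Longrightarrow> (\<lambda>\<omega>. \<omega> i) \<in> measurable (PiM {0..<t} (\<lambda>_. count_space UNIV)) (count_space UNIV)"
  by (rule measurable_component_singleton) simp

text \<open>With \<open>f = 1\<close> this drives the induction for the marginals; with indicator
  functions it shows that leaving \<open>WinA\<close> has probability zero.\<close>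

lemma nn_integral_prefix_law_pair:
  fixes f g :: "state \<Rightarrow> ennreal"
  shows "(\<integral>\<^sup>+\<omega>. f (\<omega> t) * g (\<omega> (Suc t)) \<partial>prefix_law n pA pB s0 (Suc (Suc t))) =
    (\<integral>\<^sup>+\<omega>. f (\<omega> t) * (\<integral>\<^sup>+s. g s \<partial>step n pA pB (\<omega> t)) \<partial>prefix_law n pA pB s0 (Suc t))"
proof -
  have "(\<lambda>\<omega>. f (\<omega> t) * g (\<omega> (Suc t))) \<in>
      borel_measurable (PiM {0..<Suc (Suc t)} (\<lambda>_. count_space UNIV))"
    by (intro borel_measurable_times_ennreal measurable_compose[OF measurable_prefix_component]) auto
  from nn_integral_prefix_law_Suc[OF this] show ?thesis
    by (simp add: chain_kernel_def nn_integral_cmult)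
qed

lemma nn_integral_prefix_law:
  fixes g :: "state \<Rightarrow> ennreal"
  shows "(\<integral>\<^sup>+\<omega>. g (\<omega> t) \<partial>prefix_law n pA pB s0 (Suc t)) = (\<integral>\<^sup>+s. g s \<partial>law n pA pB t s0)"
proof (induction t arbitrary: g)
  case 0
  interpret Ionescu_Tulcea "chain_kernel n pA pB s0" "\<lambda>_. count_space UNIV"
    by (rule Ionescu_Tulcea_chain_kernel)
  have p: "prob_space (prefix_law n pA pB s0 0)"
    by (rule prob_space_C) (auto simp: space_PiM PiE_iff extensional_def)
  have m: "(\<lambda>\<omega>. g (\<omega> 0)) \<in> borel_measurable (PiM {0..<Suc 0} (\<lambda>_. count_space UNIV))"
    by (rule measurable_compose[OF measurable_prefix_component]) auto
  show ?case
    unfolding nn_integral_prefix_law_Suc[OF m] using prob_space.emeasure_space_1[OF p]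
    by (simp add: chain_kernel_def[of n pA pB s0 0] del: C.simps)
next
  case (Suc t)
  show ?case
    using nn_integral_prefix_law_pair[where f = "\<lambda>_. 1" and g = g and t = t]
      Suc.IH[of "\<lambda>s. \<integral>\<^sup>+u. g u \<partial>step n pA pB s"]
    by (simp only: mult_1 law.simps nn_integral_bind_pmf)
qed


text \<open>The second assumption says that \<open>Q\<close> sees only coordinates below
  \<open>t\<close>, so the event is a cylinder.\<close>

lemma emeasure_game_law_prefix:
  assumes "{\<omega> \<in> space (PiM {0..<t} (\<lambda>_. count_space UNIV)). Q \<omega>} \<in> sets (PiM {0..<t} (\<lambda>_. count_space UNIV))"
    and "\<And>\<omega>. Q (restrict \<omega> {0..<t}) = Q \<omega>"
  shows "emeasure (game_law n pA pB s0) {\<omega> \<in> space (game_law n pA pB s0). Q \<omega>} =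
    emeasure (prefix_law n pA pB s0 t) {\<omega> \<in> space (PiM {0..<t} (\<lambda>_. count_space UNIV)). Q \<omega>}"
proof -
  have "space (game_law n pA pB s0) = space (PiM UNIV (\<lambda>_. count_space UNIV))"
    by (rule sets_eq_imp_space_eq[OF sets_game_law])
  then have "{\<omega> \<in> space (game_law n pA pB s0). Q \<omega>} =
      prod_emb UNIV (\<lambda>_. count_space UNIV) {0..<t} {\<omega> \<in> space (PiM {0..<t} (\<lambda>_. count_space UNIV)). Q \<omega>}"
    using assms(2) by (auto simp: prod_emb_def space_PiM PiE_iff)
  then show ?thesis
    using game_law_cylinder[OF assms(1)] by simp
qed

lemma sets_prefix_law: "sets (prefix_law n pA pB s0 t) = sets (PiM {0..<t} (\<lambda>_. count_space UNIV))"
proof -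
  interpret Ionescu_Tulcea "chain_kernel n pA pB s0" "\<lambda>_. count_space UNIV"
    by (rule Ionescu_Tulcea_chain_kernel)
  show ?thesis
    using sets_C[of "\<lambda>_. undefined" 0 t] by (simp add: space_PiM PiE_iff extensional_def)
qed

lemma emeasure_game_law_component:
  "emeasure (game_law n pA pB s0) {\<omega> \<in> space (game_law n pA pB s0). \<omega> t = s} =
    ennreal (pmf (law n pA pB t s0) s)"
proof -
  let ?M = "PiM {0..<Suc t} (\<lambda>_. count_space UNIV) :: (nat \<Rightarrow> state) measure"
  have [measurable]: "(\<lambda>\<omega>. \<omega> t) \<in> measurable ?M (count_space UNIV)"
    by (rule measurable_prefix_component) simp
  have m: "{\<omega> \<in> space ?M. \<omega> t = s} \<in> sets ?M"
    by measurable
  have "emeasure (game_law n pA pB s0) {\<omega> \<in> space (game_law n pA pB s0). \<omega> t = s} =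
      emeasure (prefix_law n pA pB s0 (Suc t)) {\<omega> \<in> space ?M. \<omega> t = s}"
    using m by (intro emeasure_game_law_prefix) auto
  also have "\<dots> = (\<integral>\<^sup>+\<omega>. indicator {\<omega> \<in> space ?M. \<omega> t = s} \<omega> \<partial>prefix_law n pA pB s0 (Suc t))"
    using m by (intro nn_integral_indicator[symmetric]) (simp only: sets_prefix_law)
  also have "\<dots> = (\<integral>\<^sup>+\<omega>. indicator {s} (\<omega> t) \<partial>prefix_law n pA pB s0 (Suc t))"
    using sets_eq_imp_space_eq[OF sets_prefix_law, of n pA pB s0 "Suc t"]
    by (intro nn_integral_cong) (auto split: split_indicator)
  also have "\<dots> = ennreal (pmf (law n pA pB t s0) s)"
    by (simp add: nn_integral_prefix_law emeasure_pmf_single del: Ionescu_Tulcea.C.simps)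
  finally show ?thesis .
qed

text \<open>The trajectory space contains paths that leave \<open>WinA\<close>; only the law
  excludes them, hence the almost-sure form.\<close>

lemma AE_game_law_WinA_absorbing:
  "AE \<omega> in game_law n pA pB s0. \<omega> t = WinA \<longrightarrow> \<omega> (Suc t) = WinA"
proof -
  let ?M = "PiM {0..<Suc (Suc t)} (\<lambda>_. count_space UNIV) :: (nat \<Rightarrow> state) measure"
  have [measurable]: "(\<lambda>\<omega>. \<omega> t) \<in> measurable ?M (count_space UNIV)"
      "(\<lambda>\<omega>. \<omega> (Suc t)) \<in> measurable ?M (count_space UNIV)"
    by (rule measurable_prefix_component, simp)+
  let ?E = "{\<omega> \<in> space ?M. \<omega> t = WinA \<and> \<omega> (Suc t) \<noteq> WinA}"
  have m: "?E \<in> sets ?M"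
    by measurable
  have "emeasure (game_law n pA pB s0)
        {\<omega> \<in> space (game_law n pA pB s0). \<omega> t = WinA \<and> \<omega> (Suc t) \<noteq> WinA} =
      emeasure (prefix_law n pA pB s0 (Suc (Suc t))) ?E"
    using m by (intro emeasure_game_law_prefix) auto
  also have "\<dots> = (\<integral>\<^sup>+\<omega>. indicator ?E \<omega> \<partial>prefix_law n pA pB s0 (Suc (Suc t)))"
    using m by (intro nn_integral_indicator[symmetric]) (simp only: sets_prefix_law)
  also have "\<dots> = (\<integral>\<^sup>+\<omega>. indicator {WinA} (\<omega> t) * indicator (- {WinA}) (\<omega> (Suc t))
      \<partial>prefix_law n pA pB s0 (Suc (Suc t)))"
    using sets_eq_imp_space_eq[OF sets_prefix_law, of n pA pB s0 "Suc (Suc t)"]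
    by (intro nn_integral_cong) (auto split: split_indicator)
  also have "\<dots> = (\<integral>\<^sup>+\<omega>. indicator {WinA} (\<omega> t) *
      (\<integral>\<^sup>+s. indicator (- {WinA}) s \<partial>step n pA pB (\<omega> t)) \<partial>prefix_law n pA pB s0 (Suc t))"
    by (rule nn_integral_prefix_law_pair)
  also have "\<dots> = (\<integral>\<^sup>+\<omega>. 0 \<partial>prefix_law n pA pB s0 (Suc t))"
    by (intro nn_integral_cong) (auto split: split_indicator)
  also have "\<dots> = 0"
    by simp
  finally have z: "emeasure (game_law n pA pB s0)
      {\<omega> \<in> space (game_law n pA pB s0). \<omega> t = WinA \<and> \<omega> (Suc t) \<noteq> WinA} = 0" .
  have [measurable]: "(\<lambda>\<omega>. \<omega> u) \<in> measurable (game_law n pA pB s0) (count_space UNIV)" for u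
    by (subst measurable_cong_sets[OF sets_game_law refl])
       (rule measurable_component_singleton, simp)
  have "{\<omega> \<in> space (game_law n pA pB s0). \<omega> t = WinA \<and> \<omega> (Suc t) \<noteq> WinA} \<in> sets (game_law n pA pB s0)"
    by measurable
  with z show ?thesis
    by (intro AE_I[OF _ z]) auto
qed

lemma prob_space_game_law: "prob_space (game_law n pA pB s0)"
proof -
  interpret Ionescu_Tulcea "chain_kernel n pA pB s0" "\<lambda>_. count_space UNIV"
    by (rule Ionescu_Tulcea_chain_kernel)
  have "emeasure (game_law n pA pB s0) {\<omega> \<in> space (game_law n pA pB s0). True} =
      emeasure (prefix_law n pA pB s0 0) {\<omega> \<in> space (PiM {0..<0} (\<lambda>_. count_space UNIV)). True}"
    by (rule emeasure_game_law_prefix) auto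
  also have "\<dots> = 1"
    using prob_space.emeasure_space_1[OF prob_space_C[of "\<lambda>_. undefined" 0 0]]
      space_C[of "\<lambda>_. undefined" 0 0]
    by (simp add: space_PiM PiE_iff extensional_def del: C.simps)
  finally show ?thesis
    by (intro prob_spaceI) simp
qed

text \<open>By absorption, having visited \<open>WinA\<close> by time \<open>t\<close> agrees almost
  surely with being there at time \<open>t\<close>. These events increase to the winning event, so
  continuity from below applies, and later arguments need only pmfs.\<close>

lemma pmf_law_WinA_LIMSEQ:
  "(\<lambda>t. pmf (law n pA pB t s0) WinA) \<longlonglongrightarrow> prob_A_wins n pA pB s0"
proof -
  let ?G = "game_law n pA pB s0"
  interpret prob_space ?G
    by (rule prob_space_game_law)
  have [measurable]: "(\<lambda>\<omega>. \<omega> u) \<in> measurable ?G (count_space UNIV)" for u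
    by (subst measurable_cong_sets[OF sets_game_law refl])
       (rule measurable_component_singleton, simp)
  define E where "E t = {\<omega> \<in> space ?G. \<exists>u\<le>t. \<omega> u = WinA}" for t
  have [measurable]: "E t \<in> sets ?G" for t
    unfolding E_def by measurable
  have "AE \<omega> in ?G. \<forall>t. \<omega> t = WinA \<longrightarrow> \<omega> (Suc t) = WinA"
    by (simp add: AE_all_countable AE_game_law_WinA_absorbing)
  then have "AE \<omega> in ?G. \<omega> \<in> E t \<longleftrightarrow> \<omega> \<in> {\<omega> \<in> space ?G. \<omega> t = WinA}" for t
  proof eventually_elim
    case (elim \<omega>)
    have "\<omega> (u + d) = WinA" if "\<omega> u = WinA" for u d
      using that elim by (induction d) auto
    from this[of _ "t - _"] show ?case
      by (auto simp: E_def) (metis le_add_diff_inverse)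
  qed
  then have "measure ?G (E t) = measure ?G {\<omega> \<in> space ?G. \<omega> t = WinA}" for t
    by (intro measure_eq_AE) measurable
  also have "measure ?G {\<omega> \<in> space ?G. \<omega> t = WinA} = pmf (law n pA pB t s0) WinA" for t
    by (simp add: measure_def emeasure_game_law_component)
  finally have "measure ?G (E t) = pmf (law n pA pB t s0) WinA" for t .
  moreover have "(\<lambda>t. measure ?G (E t)) \<longlonglongrightarrow> measure ?G (\<Union>t. E t)"
    by (rule finite_Lim_measure_incseq) (auto simp: incseq_def E_def intro: order_trans)
  moreover have "(\<Union>t. E t) = {\<omega> \<in> space ?G. \<exists>t. \<omega> t = WinA}"
    by (auto simp: E_def)
  ultimately show ?thesis
    by (simp add: prob_A_wins_def)
qed

section \<open>Boundary values and one-rally equations\<close>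

lemma prob_A_wins_WinA: "prob_A_wins n pA pB WinA = 1"
proof -
  have "law n pA pB t WinA = return_pmf WinA" for t
    by (induction t) (auto simp: bind_return_pmf)
  then show ?thesis
    using pmf_law_WinA_LIMSEQ[of n pA pB WinA] by (simp add: LIMSEQ_const_iff)
qed

lemma prob_A_wins_WinB: "prob_A_wins n pA pB WinB = 0"
proof -
  have "law n pA pB t WinB = return_pmf WinB" for t
    by (induction t) (auto simp: bind_return_pmf)
  then show ?thesis
    using pmf_law_WinA_LIMSEQ[of n pA pB WinB] by (simp add: LIMSEQ_const_iff)
qed

text \<open>Condition on the first rally at finite time, then pass to the limit on both
  sides.\<close>

lemma prob_A_wins_two_point:
  assumes "step n pA pB s = map_pmf (\<lambda>won. if won then u else v) (bernoulli_pmf p)" "0 \<le> p" "p \<le> 1"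
  shows "prob_A_wins n pA pB s = p * prob_A_wins n pA pB u + (1 - p) * prob_A_wins n pA pB v"
proof (rule LIMSEQ_unique)
  show "(\<lambda>t. pmf (law n pA pB (Suc t) s) WinA) \<longlonglongrightarrow> prob_A_wins n pA pB s"
    by (rule LIMSEQ_Suc[OF pmf_law_WinA_LIMSEQ])
  have "pmf (law n pA pB (Suc t) s) WinA =
      p * pmf (law n pA pB t u) WinA + (1 - p) * pmf (law n pA pB t v) WinA" for t
    unfolding law_Suc_first assms(1) using assms(2,3)
    by (simp add: pmf_bind map_pmf_def bind_assoc_pmf bind_return_pmf if_distrib)
  then show "(\<lambda>t. pmf (law n pA pB (Suc t) s) WinA) \<longlonglongrightarrow>
      p * prob_A_wins n pA pB u + (1 - p) * prob_A_wins n pA pB v"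
    by (simp del: law.simps) (intro tendsto_intros pmf_law_WinA_LIMSEQ)
qed

lemma prob_A_wins_A_serves:
  assumes "k \<in> {FirstA, SecondA}" "0 \<le> pA" "pA \<le> 1"
  shows "prob_A_wins n pA pB (Rally i j k) =
    pA * prob_A_wins n pA pB (point_A n i j k) + (1 - pA) * prob_A_wins n pA pB (Rally i j (next_server k))"
  using assms by (intro prob_A_wins_two_point) auto

lemma prob_A_wins_B_serves:
  assumes "k \<in> {FirstB, SecondB}" "0 \<le> pB" "pB \<le> 1"
  shows "prob_A_wins n pA pB (Rally i j k) =
    pB * prob_A_wins n pA pB (point_B n i j k) + (1 - pB) * prob_A_wins n pA pB (Rally i j (next_server k))"
  using assms by (intro prob_A_wins_two_point) auto

section \<open>A closed form of the advantage\<close>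

definition alt_sum :: "real \<Rightarrow> nat \<Rightarrow> nat \<Rightarrow> real" where
  "alt_sum y i j = (\<Sum>k\<le>i. of_nat (i choose k) * of_nat (j choose k) * (- y) ^ k)"

lemma alt_sum_upper:
  "i \<le> m \<Longrightarrow>
    (\<Sum>k\<le>m. of_nat (i choose k) * of_nat (j choose k) * (- y) ^ k) = alt_sum y i j"
  unfolding alt_sum_def by (rule sum.mono_neutral_right) (auto simp: binomial_eq_0)

lemma alt_sum_0 [simp]: "alt_sum y 0 j = 1"
  by (simp add: alt_sum_def)

lemma alt_sum_0_right [simp]: "alt_sum y i 0 = 1"
proof -
  have "alt_sum y i 0 = (\<Sum>k\<le>i. if k = 0 then 1 else 0)"
    unfolding alt_sum_def by (intro sum.cong) (auto simp: binomial_eq_0)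
  then show ?thesis by simp
qed

text \<open>Pascal's rule in both factors:
  \<open>(a + a') (b + b') = a (b + b') + (a + a') b - a b + a' b'\<close>, where the last product
  comes from index \<open>k\<close> and so carries the extra \<open>- y\<close>.\<close>

lemma alt_sum_Suc_Suc:
  "alt_sum y (Suc i) (Suc j) = alt_sum y i (Suc j) + alt_sum y (Suc i) j - (1 + y) * alt_sum y i j"
proof -
  let ?c = "\<lambda>i j k. of_nat (i choose k) * of_nat (j choose k) * (- y) ^ k :: real"
  have split: "(\<Sum>k\<le>Suc i. ?c m l k) = 1 + (\<Sum>k\<le>i. ?c m l (Suc k))" for m l
    by (subst sum.atMost_Suc_shift) simp
  have "alt_sum y i (Suc j) + alt_sum y (Suc i) j - (1 + y) * alt_sum y i j =
      (\<Sum>k\<le>Suc i. ?c i (Suc j) k) + (\<Sum>k\<le>Suc i. ?c (Suc i) j k) - (\<Sum>k\<le>Suc i. ?c i j k) - y * (\<Sum>k\<le>i. ?c i j k)"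
    by (simp only: alt_sum_upper[of i "Suc i"] alt_sum_upper[of "Suc i" "Suc i"] alt_sum_upper[of i i] le_refl le_SucI)
      (simp add: algebra_simps)
  also have "\<dots> = 1 + (\<Sum>k\<le>i. ?c i (Suc j) (Suc k) + ?c (Suc i) j (Suc k) - ?c i j (Suc k) - y * ?c i j k)"
    unfolding split by (simp add: sum.distrib sum_subtractf sum_distrib_left sum_negf)
  also have "(\<Sum>k\<le>i. ?c i (Suc j) (Suc k) + ?c (Suc i) j (Suc k) - ?c i j (Suc k) - y * ?c i j k) =
      (\<Sum>k\<le>i. ?c (Suc i) (Suc j) (Suc k))"
    by (intro sum.cong refl) (simp add: algebra_simps)
  also have "1 + \<dots> = alt_sum y (Suc i) (Suc j)"
    by (simp only: split[symmetric] alt_sum_def)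
  finally show ?thesis by simp
qed

text \<open>\<open>weight y i j\<close> is the value of the series
  \<open>\<Sum>c. (-y)^c * ((c + i - 1) choose c) * ((c + j - 1) choose c)\<close> for \<open>i, j > 0\<close>, and \<open>0\<close> otherwise;
  the summation index counts the rallies that each team has lost on its serve.\<close>

definition weight :: "real \<Rightarrow> nat \<Rightarrow> nat \<Rightarrow> real" where
  "weight y i j = (if i = 0 \<or> j = 0 then 0 else alt_sum y (i - 1) (j - 1) / (1 + y) ^ (i + j - 1))"

lemma weight_0 [simp]: "weight y 0 j = 0" "weight y i 0 = 0"
  by (simp_all add: weight_def)

text \<open>The recursion of \<open>alt_sum\<close>, rescaled by powers of \<open>1 + y\<close>. The
  value 0 on the axes extends it to the boundary and leaves a unit source at the origin, which will
  single out the initial score.\<close>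

lemma weight_Suc_Suc:
  assumes "1 + y \<noteq> 0"
  shows "(1 + y) * weight y (Suc i) (Suc j) =
    weight y i (Suc j) + weight y (Suc i) j - weight y i j + (if i = 0 \<and> j = 0 then 1 else 0)"
proof (cases i)
  case 0
  then show ?thesis using assms by (cases j) (auto simp: weight_def)
next
  case i: (Suc i')
  show ?thesis
  proof (cases j)
    case 0
    then show ?thesis using assms i by (auto simp: weight_def)
  next
    case j: (Suc j')
    define z where "z = 1 + y"
    have "z \<noteq> 0"
      using assms by (simp add: z_def)
    then show ?thesis
      by (simp add: i j weight_def alt_sum_Suc_Suc z_def[symmetric] field_simps)
  qed
qed

text \<open>Read \<open>h1, ..., h4\<close> at \<open>(i, j)\<close> as the winning probabilities for the four servers. Multiplying the
  four equations at \<open>(i, j)\<close> by \<open>a^i b^j\<close> times \<open>- B * u, u - w, A * u, - (u - v)\<close> with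
  \<open>u = weight y (i + 1) (j + 1)\<close>, \<open>v = weight y i (j + 1)\<close>, \<open>w = weight y (i + 1) j\<close> turns each of them
  into a conservation law, so that only boundary terms survive the summation.\<close>

lemma flux_identity:
  fixes h1 h2 h3 h4 :: "nat \<Rightarrow> nat \<Rightarrow> real"
  assumes y: "y = A * B" "1 + y \<noteq> 0"
    and h1: "\<And>i j. i < n \<Longrightarrow> j < n \<Longrightarrow> h1 i j = a * h1 (Suc i) j + A * h2 i j"
    and h2: "\<And>i j. i < n \<Longrightarrow> j < n \<Longrightarrow> h2 i j = a * h2 (Suc i) j + A * h3 i j"
    and h3: "\<And>i j. i < n \<Longrightarrow> j < n \<Longrightarrow> h3 i j = b * h3 i (Suc j) + B * h4 i j"
    and h4: "\<And>i j. i < n \<Longrightarrow> j < n \<Longrightarrow> h4 i j = b * h4 i (Suc j) + B * h1 i j"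
    and n: "n > 0"
  shows "h2 0 0 - h4 0 0 =
    (\<Sum>j<n. a ^ n * b ^ j * (- B * weight y n (Suc j) * h1 n j + (weight y n (Suc j) - weight y n j) * h2 n j)) +
    (\<Sum>i<n. a ^ i * b ^ n * (A * weight y (Suc i) n * h3 i n - (weight y (Suc i) n - weight y i n) * h4 i n))"
proof -
  let ?T = "weight y"
  \<comment> \<open>\<open>f\<close> and \<open>g\<close> are the fluxes in the directions of Team
    A's and Team B's points; \<open>s\<close> is the source at score \<open>(0, 0)\<close>.\<close>
  define f where "f i j = a ^ i * b ^ j * (- B * ?T i (Suc j) * h1 i j + (?T i (Suc j) - ?T i j) * h2 i j)" for i j
  define g where "g i j = a ^ i * b ^ j * (A * ?T (Suc i) j * h3 i j - (?T (Suc i) j - ?T i j) * h4 i j)" for i j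
  define s where "s i j = (if i = 0 \<and> j = 0 then h2 0 0 - h4 0 0 else 0)" for i j :: nat
  have cons: "(f (Suc i) j - f i j) + (g i (Suc j) - g i j) = s i j" if "i < n" "j < n" for i j
  proof -
    define u v w t where "u = ?T (Suc i) (Suc j)" and "v = ?T i (Suc j)" and "w = ?T (Suc i) j" and "t = ?T i j"
    define r :: real where "r = (if i = 0 \<and> j = 0 then 1 else 0)"
    have T: "(1 + y) * u = v + w - t + r"
      unfolding u_def v_def w_def t_def r_def by (rule weight_Suc_Suc[OF y(2)])
    define x1 x2 x3 x4 where "x1 = h1 (Suc i) j" and "x2 = h2 (Suc i) j" and "x3 = h3 i (Suc j)" and "x4 = h4 i (Suc j)"
    define z1 z2 z3 z4 where "z1 = h1 i j" and "z2 = h2 i j" and "z3 = h3 i j" and "z4 = h4 i j"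
    have e: "a * x1 = z1 - A * z2" "a * x2 = z2 - A * z3" "b * x3 = z3 - B * z4" "b * x4 = z4 - B * z1"
      using h1[OF that] h2[OF that] h3[OF that] h4[OF that]
      by (simp_all add: x1_def x2_def x3_def x4_def z1_def z2_def z3_def z4_def)
    have r: "r = u + A * B * u - v - w + t"
      using T by (simp add: y(1) algebra_simps)
    have "s i j = a ^ i * b ^ j * (r * (z2 - z4))"
      by (simp add: s_def r_def z2_def z4_def)
    also have "r * (z2 - z4) =
        (- B * u * (z1 - A * z2) + (u - w) * (z2 - A * z3)) - (- B * v * z1 + (v - t) * z2)
        + ((A * u * (z3 - B * z4) - (u - v) * (z4 - B * z1)) - (A * w * z3 - (w - t) * z4))"
      unfolding r by (simp add: algebra_simps)
    also have "\<dots> = (- B * u * (a * x1) + (u - w) * (a * x2)) - (- B * v * z1 + (v - t) * z2)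
        + ((A * u * (b * x3) - (u - v) * (b * x4)) - (A * w * z3 - (w - t) * z4))"
      by (simp only: e)
    also have "a ^ i * b ^ j * \<dots> = (f (Suc i) j - f i j) + (g i (Suc j) - g i j)"
      unfolding f_def g_def u_def[symmetric] v_def[symmetric] w_def[symmetric] t_def[symmetric]
        x1_def[symmetric] x2_def[symmetric] x3_def[symmetric] x4_def[symmetric]
        z1_def[symmetric] z2_def[symmetric] z3_def[symmetric] z4_def[symmetric]
      by (simp add: algebra_simps)
    finally show ?thesis by simp
  qed
  have "h2 0 0 - h4 0 0 = (\<Sum>i<n. \<Sum>j<n. s i j)"
  proof -
    have "(\<Sum>i<n. \<Sum>j<n. s i j) = (\<Sum>i<n. if i = 0 then h2 0 0 - h4 0 0 else 0)"
    proof (intro sum.cong refl)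
      fix i
      have "(\<Sum>j<n. s i j) = (\<Sum>j<n. if j = 0 then (if i = 0 then h2 0 0 - h4 0 0 else 0) else 0)"
        by (intro sum.cong) (auto simp: s_def)
      also have "\<dots> = (if i = 0 then h2 0 0 - h4 0 0 else 0)"
        using n by (subst sum.delta) auto
      finally show "(\<Sum>j<n. s i j) = (if i = 0 then h2 0 0 - h4 0 0 else 0)" .
    qed
    also have "\<dots> = h2 0 0 - h4 0 0"
      using n by (subst sum.delta) auto
    finally show ?thesis by simp
  qed
  also have "\<dots> = (\<Sum>i<n. \<Sum>j<n. (f (Suc i) j - f i j) + (g i (Suc j) - g i j))"
    by (intro sum.cong refl) (simp add: cons)
  also have "\<dots> = (\<Sum>j<n. \<Sum>i<n. f (Suc i) j - f i j) + (\<Sum>i<n. \<Sum>j<n. g i (Suc j) - g i j)"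
    by (simp only: sum.distrib) (simp add: sum.swap[of "\<lambda>i j. f (Suc i) j - f i j"])
  also have "\<dots> = (\<Sum>j<n. f n j - f 0 j) + (\<Sum>i<n. g i n - g i 0)"
    by (simp only: sum_lessThan_telescope sum_lessThan_telescope[of "\<lambda>i. f i j" for j])
  \<comment> \<open>\<open>weight\<close> vanishes on both axes, so there is no flux through
    \<open>i = 0\<close> or \<open>j = 0\<close>.\<close>
  also have "\<dots> = (\<Sum>j<n. f n j) + (\<Sum>i<n. g i n)"
    by (simp add: f_def g_def)
  finally show ?thesis
    unfolding f_def g_def .
qed

text \<open>\<open>d\<close>, \<open>e\<close>, \<open>g\<close> are the winning probabilities at \<open>(n - 1, n - 1)\<close>, \<open>(n, n - 1)\<close>, \<open>(n - 1, n)\<close>.\<close>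

lemma deuce_identity:
  fixes A B :: real
  defines "a \<equiv> 1 - A" and "b \<equiv> 1 - B" and "y \<equiv> A * B"
  assumes d: "d1 = a * e1 + A * d2" "d2 = a * e2 + A * d3" "d3 = b * g3 + B * d4" "d4 = b * g4 + B * d1"
    and e: "e1 = a + A * e2" "e2 = a + A * e3" "e3 = b * d3 + B * e4" "e4 = b * d4 + B * e1"
    and g: "g1 = a * d1 + A * g2" "g2 = a * d2 + A * g3" "g3 = B * g4" "g4 = B * g1"
    and y: "y \<noteq> 1"
  shows "(a * (1 - e2) + b * g4) * ((1 - y) * (1 + y)\<^sup>2 + a * b * y * (3 - y)) =
    a * b * ((A + B) * (1 - y) + 2 * y * (1 + y))"
proof -
  \<comment> \<open>Elimination leaves two unknowns, \<open>p\<close> and \<open>g1\<close>,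
    belonging to the trailing team's first server at the two scores next to deuce.\<close>
  define p where "p = 1 - e3"
  have e3: "e3 = 1 - p"
    by (simp add: p_def)
  have e2: "e2 = 1 - A * p"
    unfolding e(2) e3 a_def by (simp add: algebra_simps)
  have e1: "e1 = 1 - A\<^sup>2 * p"
    unfolding e(1) e2 a_def by (simp add: algebra_simps power2_eq_square)
  have g3: "g3 = B\<^sup>2 * g1"
    unfolding g(3) g(4) by (simp add: power2_eq_square)
  have p: "p * (1 - y\<^sup>2) = b * (1 - d3) + B * b * (1 - d4)"
    using e(3) unfolding e(4) e3 e1 b_def y_def by (simp add: algebra_simps power2_eq_square)
  have q: "g1 * (1 - y\<^sup>2) = a * d1 + A * a * d2"
    using g(1) unfolding g(2) g3 y_def by (simp add: algebra_simps power2_eq_square)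
  define x where "x = a * (1 + A - 2 * A\<^sup>2 * p)"
  define z where "z = 2 * b * g1"
  have dd: "d1 = x + A\<^sup>2 * d3" "d3 = B\<^sup>2 * z + B\<^sup>2 * d1"
  proof -
    show "d1 = x + A\<^sup>2 * d3"
      unfolding d(1)[unfolded d(2)] e1 e2 x_def by (simp add: algebra_simps power2_eq_square)
    show "d3 = B\<^sup>2 * z + B\<^sup>2 * d1"
      unfolding d(3)[unfolded d(4)] g3 g(4) z_def by (simp add: algebra_simps power2_eq_square)
  qed
  define D where "D = 1 - y\<^sup>2"
  have Dd1: "D * d1 = x + y\<^sup>2 * z"
    using dd(1) unfolding dd(2) D_def y_def by (simp add: algebra_simps power2_eq_square)
  have Dd3: "D * d3 = B\<^sup>2 * z + B\<^sup>2 * x"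
    using dd(2) unfolding dd(1) D_def y_def by (simp add: algebra_simps power2_eq_square)
  have "D\<^sup>2 * g1 = a * (D * d1) + A * a * (D * d2)"
    using arg_cong[OF q, of "\<lambda>t. D * t"] by (simp add: D_def algebra_simps power2_eq_square)
  also have "D * d2 = D * (a * e2) + A * (D * d3)"
    unfolding d(2) by (simp add: algebra_simps)
  finally have eq1: "(D\<^sup>2 - 4 * a * b * y\<^sup>2) * g1 + a\<^sup>2 * A\<^sup>2 * (3 + y\<^sup>2) * p = a\<^sup>2 * (1 + y\<^sup>2 + 2 * A)"
    unfolding Dd1 Dd3 unfolding e2 x_def z_def D_def y_def by (simp add: algebra_simps power2_eq_square)
  have "D\<^sup>2 * p = b * (D - D * d3) + B * b * (D - D * d4)"
    using arg_cong[OF p, of "\<lambda>t. D * t"] by (simp add: D_def algebra_simps power2_eq_square)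
  also have "D * d4 = D * (b * (B * g1)) + B * (D * d1)"
    unfolding d(4) g(4) by (simp add: algebra_simps)
  finally have eq2: "(D\<^sup>2 - 4 * a * b * y\<^sup>2) * p + b\<^sup>2 * B\<^sup>2 * (3 + y\<^sup>2) * g1 = b\<^sup>2 * (1 + y\<^sup>2 + 2 * B)"
    unfolding Dd1 Dd3 unfolding x_def z_def D_def y_def a_def b_def by (simp add: algebra_simps power2_eq_square)
  \<comment> \<open>The wanted quantity is \<open>a * A * p + b * B * g1\<close>, and the row
    \<open>(a * A, b * B)\<close> is a left eigenvector of the system \<open>eq2\<close>,
    \<open>eq1\<close> in \<open>(p, g1)\<close>. The two sides then share the factor
    \<open>1 - y\<close>.\<close>
  have "(a * (1 - e2) + b * g4) * (D\<^sup>2 - 4 * a * b * y\<^sup>2 + a * b * y * (3 + y\<^sup>2)) =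
      a * A * ((D\<^sup>2 - 4 * a * b * y\<^sup>2) * p + b\<^sup>2 * B\<^sup>2 * (3 + y\<^sup>2) * g1) +
      b * B * ((D\<^sup>2 - 4 * a * b * y\<^sup>2) * g1 + a\<^sup>2 * A\<^sup>2 * (3 + y\<^sup>2) * p)"
    unfolding e2 g(4) y_def by (simp add: algebra_simps power2_eq_square)
  also have "\<dots> = a * b * ((b * A + a * B) * (1 + y\<^sup>2) + 2 * y * (a + b))"
    unfolding eq1 eq2 unfolding y_def by (simp add: algebra_simps power2_eq_square)
  also have "\<dots> = (1 - y) * (a * b * ((A + B) * (1 - y) + 2 * y * (1 + y)))"
    unfolding y_def a_def b_def by (simp add: algebra_simps power2_eq_square)
  also have "D\<^sup>2 - 4 * a * b * y\<^sup>2 + a * b * y * (3 + y\<^sup>2) =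
      (1 - y) * ((1 - y) * (1 + y)\<^sup>2 + a * b * y * (3 - y))"
    unfolding D_def by (simp add: algebra_simps power2_eq_square)
  finally show ?thesis
    using y by simp
qed

section \<open>Assembling the closed form\<close>

lemma alt_sum_commute: "alt_sum y i j = alt_sum y j i"
proof -
  have "alt_sum y i j = (\<Sum>k\<le>max i j. of_nat (i choose k) * of_nat (j choose k) * (- y) ^ k)"
    by (rule alt_sum_upper[symmetric]) simp
  also have "\<dots> = (\<Sum>k\<le>max i j. of_nat (j choose k) * of_nat (i choose k) * (- y) ^ k)"
    by (simp add: mult.commute)
  also have "\<dots> = alt_sum y j i"
    by (rule alt_sum_upper) simp
  finally show ?thesis .
qed

lemma weight_commute: "weight y i j = weight y j i"
  unfolding weight_def alt_sum_commute[of y "i - 1" "j - 1"] add.commute[of i j] by simp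

text \<open>Extends \<open>Rally\<close> by the scores at which the game is already decided, so that every rally at a score
  in \<open>{0..<n} \<times> {0..<n}\<close>, deuce included, leads to a cell.\<close>

definition cell :: "nat \<Rightarrow> nat \<Rightarrow> nat \<Rightarrow> server \<Rightarrow> state" where
  "cell n i j k =
    (if i = n \<and> j + 2 \<le> n then WinA else if j = n \<and> i + 2 \<le> n then WinB else Rally i j k)"

text \<open>In the flux identity the boundary values are 1 or 0 except at the two scores next to
  deuce, whose contribution enters only through \<open>\<gamma>\<close>, which
  \<open>deuce_identity\<close> supplies.\<close>

lemma advantage_formula:
  fixes pA pB :: real
  assumes n: "n \<ge> 2" and p: "0 < pA" "pA < 1" "0 < pB" "pB < 1"
  defines "y \<equiv> (1 - pA) * (1 - pB)"
  shows "advantage n pA pB * (((1 - y) * (1 + y)\<^sup>2 + pA * pB * y * (3 - y)) * (1 + y) ^ (2 * n - 2)) =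
    (pA * pB) ^ n * (pA * pB * alt_sum y (n - 1) (n - 1) +
      ((1 - pA + (1 - pB)) * (1 - y) + 2 * y * (1 + y)) * alt_sum y (n - 1) (n - 2))"
proof -
  define A B where "A = 1 - pA" and "B = 1 - pB"
  have AB: "pA = 1 - A" "pB = 1 - B" "0 < A" "A < 1" "0 < B" "B < 1"
    using p by (auto simp: A_def B_def)
  have "A * B < 1 * 1"
    using AB by (intro mult_strict_mono) auto
  then have y: "y = A * B" "0 < y" "y < 1"
    using AB unfolding y_def A_def[symmetric] B_def[symmetric] by simp_all
  define m where "m = n - 2"
  then have m: "n = Suc (Suc m)"
    using n by simp
  define h where "h i j k = prob_A_wins n pA pB (cell n i j k)" for i j k
  have cell: "cell n i j k = Rally i j k" if "i < n" "j < n" for i j k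
    using that by (simp add: cell_def)
  have point_A: "point_A n i j k = cell n (Suc i) j k" if "i < n" "j < n" for i j k
    using that n by (auto simp: cell_def point_A_def)
  have point_B: "point_B n i j k = cell n i (Suc j) k" if "i < n" "j < n" for i j k
    using that n by (auto simp: cell_def point_B_def)
  have hA: "h i j k = pA * h (Suc i) j k + A * h i j (next_server k)"
    if "i < n" "j < n" "k \<in> {FirstA, SecondA}" for i j k
    unfolding h_def A_def cell[OF that(1,2)] point_A[OF that(1,2), symmetric]
    using p by (intro prob_A_wins_A_serves[OF that(3)]) auto
  have hB: "h i j k = pB * h i (Suc j) k + B * h i j (next_server k)"
    if "i < n" "j < n" "k \<in> {FirstB, SecondB}" for i j k
    unfolding h_def B_def cell[OF that(1,2)] point_B[OF that(1,2), symmetric]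
    using p by (intro prob_A_wins_B_serves[OF that(3)]) auto
  define d1 d2 d3 d4 where "d1 = h (n - 1) (n - 1) FirstA" and "d2 = h (n - 1) (n - 1) SecondA"
    and "d3 = h (n - 1) (n - 1) FirstB" and "d4 = h (n - 1) (n - 1) SecondB"
  define e1 e2 e3 e4 where "e1 = h n (n - 1) FirstA" and "e2 = h n (n - 1) SecondA"
    and "e3 = h n (n - 1) FirstB" and "e4 = h n (n - 1) SecondB"
  define g1 g2 g3 g4 where "g1 = h (n - 1) n FirstA" and "g2 = h (n - 1) n SecondA"
    and "g3 = h (n - 1) n FirstB" and "g4 = h (n - 1) n SecondB"
  have d: "d1 = pA * e1 + A * d2" "d2 = pA * e2 + A * d3" "d3 = pB * g3 + B * d4" "d4 = pB * g4 + B * d1"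
    unfolding d1_def d2_def d3_def d4_def e1_def e2_def g3_def g4_def
    using hA[of "n - 1" "n - 1" FirstA] hA[of "n - 1" "n - 1" SecondA]
      hB[of "n - 1" "n - 1" FirstB] hB[of "n - 1" "n - 1" SecondB] n
    by (simp_all only: next_server.simps) auto
  have cell': "cell n n (n - 1) k = Rally n (n - 1) k" "cell n (n - 1) n k = Rally (n - 1) n k" for k
    using n by (auto simp: cell_def)
  have point': "point_A n n (n - 1) k = WinA" "point_B n n (n - 1) k = Rally (n - 1) (n - 1) k"
      "point_A n (n - 1) n k = Rally (n - 1) (n - 1) k" "point_B n (n - 1) n k = WinB" for k
    using n by (auto simp: point_A_def point_B_def)
  note serves = prob_A_wins_A_serves[of FirstA pA n pB] prob_A_wins_A_serves[of SecondA pA n pB]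
    prob_A_wins_B_serves[of FirstB pB n pA] prob_A_wins_B_serves[of SecondB pB n pA]
  have e1: "e1 = pA + A * e2" and e2: "e2 = pA + A * e3"
    unfolding e1_def e2_def e3_def h_def cell' A_def
    using serves(1)[of n "n - 1"] serves(2)[of n "n - 1"] p
    by (simp_all only: point' prob_A_wins_WinA next_server.simps) auto
  have e3: "e3 = pB * d3 + B * e4" and e4: "e4 = pB * d4 + B * e1"
    unfolding e1_def e3_def e4_def d3_def d4_def h_def cell' B_def
    using serves(3)[of n "n - 1"] serves(4)[of n "n - 1"] p n
    by (simp_all only: point' next_server.simps cell) auto
  note e = e1 e2 e3 e4
  have g1: "g1 = pA * d1 + A * g2" and g2: "g2 = pA * d2 + A * g3"
    unfolding g1_def g2_def g3_def d1_def d2_def h_def cell' A_def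
    using serves(1)[of "n - 1" n] serves(2)[of "n - 1" n] p n
    by (simp_all only: point' next_server.simps cell) auto
  have g3: "g3 = B * g4" and g4: "g4 = B * g1"
    unfolding g1_def g3_def g4_def h_def cell' B_def
    using serves(3)[of "n - 1" n] serves(4)[of "n - 1" n] p
    by (simp_all only: point' prob_A_wins_WinB next_server.simps) auto
  note g = g1 g2 g3 g4
  define \<gamma> where "\<gamma> = pA * (1 - e2) + pB * g4"
  define G where "G = (1 - y) * (1 + y)\<^sup>2 + pA * pB * y * (3 - y)"
  define N where "N = (A + B) * (1 - y) + 2 * y * (1 + y)"
  have \<gamma>: "\<gamma> * G = pA * pB * N"
    unfolding \<gamma>_def G_def N_def AB(1,2) y(1)
    using y by (intro deuce_identity[OF d[unfolded AB(1,2)] e[unfolded AB(1,2)] g[unfolded AB(1,2)]]) simp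
  define T where "T = weight y n n"
  define T' where "T' = weight y n (Suc m)"
  have "advantage n pA pB = h 0 0 SecondA - h 0 0 SecondB"
    using n by (simp add: advantage_def h_def cell_def)
  also have "\<dots> = (\<Sum>j<n. pA ^ n * pB ^ j * (- B * weight y n (Suc j) * h n j FirstA + (weight y n (Suc j) - weight y n j) * h n j SecondA)) +
      (\<Sum>i<n. pA ^ i * pB ^ n * (A * weight y (Suc i) n * h i n FirstB - (weight y (Suc i) n - weight y i n) * h i n SecondB))"
  proof (rule flux_identity[OF y(1)])
    fix i j assume "i < n" "j < n"
    then show "h i j FirstA = pA * h (Suc i) j FirstA + A * h i j SecondA"
      "h i j SecondA = pA * h (Suc i) j SecondA + A * h i j FirstB"
      "h i j FirstB = pB * h i (Suc j) FirstB + B * h i j SecondB"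
      "h i j SecondB = pB * h i (Suc j) SecondB + B * h i j FirstA"
      using hA[of i j FirstA] hA[of i j SecondA] hB[of i j FirstB] hB[of i j SecondB]
      by (simp_all only: next_server.simps) auto
  qed (use y n in auto)
  \<comment> \<open>With every \<open>h n j\<close> equal to 1 the sum would telescope, because
    \<open>1 - B = pB\<close>. The true values differ from 1 only at \<open>j = n - 1\<close>, which
    gives the subtracted correction.\<close>
  also have "(\<Sum>j<n. pA ^ n * pB ^ j * (- B * weight y n (Suc j) * h n j FirstA + (weight y n (Suc j) - weight y n j) * h n j SecondA)) =
      pA ^ n * (\<Sum>j<n. pB ^ Suc j * weight y n (Suc j) - pB ^ j * weight y n j) -
      pA ^ n * pB ^ Suc m * (- B * T * (1 - e1) + (T - T') * (1 - e2))"
  proof -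
    have "h n j k = 1" if "j < Suc m" for j k
      using that by (simp add: h_def cell_def m prob_A_wins_WinA)
    then have "(\<Sum>j<Suc m. pA ^ n * pB ^ j * (- B * weight y n (Suc j) * h n j FirstA + (weight y n (Suc j) - weight y n j) * h n j SecondA)) =
        pA ^ n * (\<Sum>j<Suc m. pB ^ Suc j * weight y n (Suc j) - pB ^ j * weight y n j)"
      unfolding sum_distrib_left by (intro sum.cong refl) (simp add: AB(2) algebra_simps)
    then show ?thesis
      unfolding m by (subst (1 2) sum.lessThan_Suc)
        (simp add: m T_def T'_def e1_def e2_def AB(2) algebra_simps)
  qed
  also have "(\<Sum>j<n. pB ^ Suc j * weight y n (Suc j) - pB ^ j * weight y n j) = pB ^ n * T"
    by (subst sum_lessThan_telescope[of "\<lambda>j. pB ^ j * weight y n j"]) (simp add: T_def)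
  also have "(\<Sum>i<n. pA ^ i * pB ^ n * (A * weight y (Suc i) n * h i n FirstB - (weight y (Suc i) n - weight y i n) * h i n SecondB)) =
      pA ^ Suc m * pB ^ n * (A * T * g3 - (T - T') * g4)"
  proof -
    have "h i n k = 0" if "i < Suc m" for i k
      using that by (simp add: h_def cell_def m prob_A_wins_WinB)
    then show ?thesis
      unfolding m by (subst sum.lessThan_Suc)
        (simp add: m T_def T'_def g3_def g4_def weight_commute[of y "Suc m" "Suc (Suc m)"])
  qed
  also have "pA ^ n * (pB ^ n * T) - pA ^ n * pB ^ Suc m * (- B * T * (1 - e1) + (T - T') * (1 - e2)) +
      pA ^ Suc m * pB ^ n * (A * T * g3 - (T - T') * g4) =
      (pA * pB) ^ Suc m * (T * (pA * pB + pA * B * (1 - e1) + pB * A * g3 - \<gamma>) + T' * \<gamma>)"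
    unfolding m \<gamma>_def by (simp add: power_mult_distrib algebra_simps)
  also have "pA * pB + pA * B * (1 - e1) + pB * A * g3 = pA * pB + y * \<gamma>"
    unfolding \<gamma>_def e(1) g(3) y(1) AB(1) by (simp add: algebra_simps)
  finally have adv: "advantage n pA pB = (pA * pB) ^ Suc m * (T * (pA * pB + y * \<gamma> - \<gamma>) + T' * \<gamma>)" .
  have z: "1 + y \<noteq> 0"
    using y by simp
  have T: "T * (1 + y) ^ (2 * n - 2) * (1 + y) = alt_sum y (n - 1) (n - 1)"
    using z by (simp add: T_def weight_def m mult_2)
  have T': "T' * (1 + y) ^ (2 * n - 2) = alt_sum y (n - 1) (n - 2)"
    using z by (simp add: T'_def weight_def m mult_2)
  have "advantage n pA pB * (G * (1 + y) ^ (2 * n - 2)) = (pA * pB) ^ Suc m *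
      (T * (1 + y) ^ (2 * n - 2) * (pA * pB * G - (1 - y) * (\<gamma> * G)) + T' * (1 + y) ^ (2 * n - 2) * (\<gamma> * G))"
    unfolding adv by (simp add: algebra_simps)
  also have "pA * pB * G - (1 - y) * (\<gamma> * G) = pA * pB * (G - (1 - y) * N)"
    unfolding \<gamma> by (simp add: algebra_simps)
  \<comment> \<open>The factor \<open>1 + y\<close> found here is the one that \<open>T\<close>,
    with denominator exponent \<open>2 * n - 1\<close>, needs beyond
    \<open>2 * n - 2\<close>.\<close>
  also have "G - (1 - y) * N = (1 + y) * (pA * pB)"
    unfolding G_def N_def y(1) AB(1,2) by (simp add: algebra_simps power2_eq_square)
  also have "T * (1 + y) ^ (2 * n - 2) * (pA * pB * ((1 + y) * (pA * pB))) =
      (T * (1 + y) ^ (2 * n - 2) * (1 + y)) * (pA * pB) * (pA * pB)"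
    by (simp add: algebra_simps)
  also have "(pA * pB) ^ Suc m * (T * (1 + y) ^ (2 * n - 2) * (1 + y) * (pA * pB) * (pA * pB) +
        T' * (1 + y) ^ (2 * n - 2) * (\<gamma> * G)) =
      (pA * pB) ^ n * (pA * pB * alt_sum y (n - 1) (n - 1) + N * alt_sum y (n - 1) (n - 2))"
    unfolding T T' \<gamma> by (simp add: m algebra_simps)
  finally show ?thesis
    unfolding G_def N_def A_def B_def by simp
qed

section \<open>Sign certificates for polynomials\<close>

fun evl :: "int list \<Rightarrow> real \<Rightarrow> real" where
  "evl [] x = 0"
| "evl (c # cs) x = of_int c + x * evl cs x"

fun padd :: "int list \<Rightarrow> int list \<Rightarrow> int list" where
  "padd [] q = q"
| "padd p [] = p"
| "padd (a # p) (b # q) = (a + b) # padd p q"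

fun pscale :: "int \<Rightarrow> int list \<Rightarrow> int list" where
  "pscale c [] = []"
| "pscale c (a # p) = c * a # pscale c p"

fun pmul :: "int list \<Rightarrow> int list \<Rightarrow> int list" where
  "pmul [] q = []"
| "pmul (a # p) q = padd (pscale a q) (0 # pmul p q)"

fun pdbl :: "int list \<Rightarrow> int list" where
  "pdbl [] = []"
| "pdbl (a # p) = a # 0 # pdbl p"

fun pder :: "int list \<Rightarrow> int list" where
  "pder [] = []"
| "pder (a # p) = padd p (0 # pder p)"

lemma evl_padd [simp]: "evl (padd p q) x = evl p x + evl q x"
  by (induction p q rule: padd.induct) (auto simp: algebra_simps)

lemma evl_pscale [simp]: "evl (pscale c p) x = of_int c * evl p x"
  by (induction p) (auto simp: algebra_simps)

lemma evl_pmul [simp]: "evl (pmul p q) x = evl p x * evl q x"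
  by (induction p) (auto simp: algebra_simps)

lemma evl_pdbl [simp]: "evl (pdbl p) x = evl p (x * x)"
  by (induction p) (auto simp: algebra_simps)

lemma DERIV_evl: "(evl p has_real_derivative evl (pder p) x) (at x)"
proof (induction p)
  case (Cons a p)
  have "((\<lambda>x. of_int a + x * evl p x) has_real_derivative 0 + (1 * evl p x + evl (pder p) x * x)) (at x)"
    by (intro DERIV_add DERIV_const DERIV_mult DERIV_ident Cons.IH)
  then show ?case
    by (simp add: mult.commute)
qed simp

text \<open>\<open>homog L R d cs\<close> computes the coefficients of \<open>(d (1 + t))^(n - 1) * cs ((L + R t) / (d (1 + t)))\<close>,
  whose values at \<open>t \<ge> 0\<close> have the signs of \<open>cs\<close> on \<open>[L / d, R / d)\<close>, together with \<open>(d (1 + t))^n\<close>,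
  where \<open>n\<close> is the number of coefficients.\<close>

fun homog :: "int \<Rightarrow> int \<Rightarrow> int \<Rightarrow> int list \<Rightarrow> int list \<times> int list" where
  "homog L R d [] = ([], [1])"
| "homog L R d (c # cs) = (case homog L R d cs of (h, e) \<Rightarrow>
    (padd (pscale c e) (padd (pscale L h) (0 # pscale R h)), padd (pscale d e) (0 # pscale d e)))"

text \<open>Horner's rule in homogeneous form. The additional factor \<open>d (1 + t)\<close> on the
  left gives both sides the same exponent, so the empty list fits as well.\<close>

lemma evl_homog:
  fixes t x :: real
  assumes "homog L R d cs = (h, e)" "x * (of_int d * (1 + t)) = of_int L + of_int R * t" "0 < of_int d * (1 + t)"
  shows "evl h t * (of_int d * (1 + t)) = evl cs x * evl e t \<and> 0 < evl e t"
  using assms(1)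
proof (induction cs arbitrary: h e)
  case (Cons c cs)
  obtain h' e' where he: "homog L R d cs = (h', e')"
    by fastforce
  define D where "D = of_int d * (1 + t)"
  have IH: "evl h' t * D = evl cs x * evl e' t" "0 < evl e' t"
    using Cons.IH[OF he] by (simp_all add: D_def)
  have h: "evl h t = of_int c * evl e' t + x * D * evl h' t" and e: "evl e t = D * evl e' t"
    using Cons.prems assms(2) by (auto simp: he D_def algebra_simps)
  have "evl h t * D = of_int c * evl e' t * D + x * D * (evl h' t * D)"
    unfolding h by (simp add: algebra_simps)
  also have "\<dots> = (of_int c + x * evl cs x) * evl e t"
    unfolding IH e by (simp add: algebra_simps)
  finally show ?case
    using IH(2) assms(3) e by (simp add: D_def)
qed simp

lemma evl_pos:
  assumes "list_all (\<lambda>c. c > 0) h" "h \<noteq> []" "t \<ge> 0"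
  shows "evl h t > 0"
  using assms(1,2)
proof (induction h)
  case (Cons c h)
  then show ?case
    using assms(3) by (cases "h = []") (auto intro!: add_pos_nonneg)
qed simp

definition pos_on :: "int \<Rightarrow> int \<Rightarrow> int \<Rightarrow> int list \<Rightarrow> bool" where
  "pos_on L R d cs \<longleftrightarrow> 0 < d \<and> cs \<noteq> [] \<and> list_all (\<lambda>c. c > 0) (fst (homog L R d cs))"

lemma padd_eq_Nil_iff: "padd p q = [] \<longleftrightarrow> p = [] \<and> q = []"
  by (cases p; cases q) auto

lemma pos_onD:
  assumes "pos_on L R d cs" "of_int L / of_int d \<le> x" "x < of_int R / of_int d"
  shows "evl cs x > 0"
proof -
  have d: "0 < (of_int d :: real)" and ne: "cs \<noteq> []" and pos: "list_all (\<lambda>c. c > 0) (fst (homog L R d cs))"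
    using assms(1) by (auto simp: pos_on_def)
  \<comment> \<open>Inverse of the Moebius map \<open>t \<mapsto> (L + R t) / (d (1 + t))\<close>,
    which for \<open>L < R\<close> takes the nonnegative reals onto the half-open interval.\<close>
  define t where "t = (x * of_int d - of_int L) / (of_int R - x * of_int d)"
  have u: "0 < of_int R - x * of_int d" and l: "0 \<le> x * of_int d - of_int L"
    using assms(2,3) d by (auto simp: field_simps)
  then have t: "t \<ge> 0"
    by (simp add: t_def)
  have "t * (of_int R - x * of_int d) = x * of_int d - of_int L"
    using u by (simp add: t_def)
  then have x: "x * (of_int d * (1 + t)) = of_int L + of_int R * t"
    by (simp add: algebra_simps)
  obtain h e where he: "homog L R d cs = (h, e)"
    by fastforce
  have "h \<noteq> []"
    using he ne by (cases cs) (auto split: prod.splits simp: padd_eq_Nil_iff)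
  then have "0 < evl h t"
    using evl_pos[OF _ _ t] pos he by simp
  moreover have D: "0 < of_int d * (1 + t)"
    using d t by simp
  ultimately have "0 < evl cs x * evl e t" "0 < evl e t"
    using evl_homog[OF he x D] by (metis mult_pos_pos)+
  then show ?thesis
    by (simp add: zero_less_mult_iff)
qed

lemma evl_map_upt: "evl (map f [0..<n]) x = (\<Sum>k<n. of_int (f k) * x ^ k)"
proof -
  have "evl (p @ [c]) x = evl p x + of_int c * x ^ length p" for p c
    by (induction p) (auto simp: algebra_simps)
  then show ?thesis
    by (induction n) auto
qed

lemma alt_sum_eq_evl:
  "alt_sum y i j = evl (map (\<lambda>k. (-1) ^ k * int (i choose k) * int (j choose k)) [0..<Suc i]) y"
  unfolding evl_map_upt alt_sum_def lessThan_Suc_atMost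
  by (intro sum.cong) (auto simp: power_minus[of y])

text \<open>Up to the substitution \<open>c = (1 - y) / (1 + y)\<close> and a power of \<open>1 + y\<close>, \<open>leg\<close> is the Legendre
  polynomial of degree 10 and \<open>jac\<close> is a Jacobi polynomial of degree 9.\<close>

definition leg :: "int list" where
  "leg = [1, -100, 2025, -14400, 44100, -63504, 44100, -14400, 2025, -100, 1]"

definition jac :: "int list" where
  "jac = [1, -90, 1620, -10080, 26460, -31752, 17640, -4320, 405, -10]"

text \<open>The coefficients of the sign-deciding polynomial on the diagonal, in
  \<open>r = 1 - x\<close>.\<close>

definition diag :: "int list" where
  "diag = [1, 0, -97, 18, 1747, -630, -9315, 5400, 12780, -15120, 13356, 10584, -29988, 10584, 1476,
     -15120, 14265, 5400, -5905, -630, 691, 18, -19]"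

lemma choose_10: "map (\<lambda>k. 10 choose k) [0..<11] = [1, 10, 45, 120, 210, 252, 210, 120, 45, 10, 1]"
  by (simp add: numeral_eq_Suc)

lemma choose_9: "map (\<lambda>k. 9 choose k) [0..<11] = [1, 9, 36, 84, 126, 126, 84, 36, 9, 1, 0]"
  by (simp add: numeral_eq_Suc)

lemma alt_sum_10_10: "alt_sum y 10 10 = evl leg y"
  using choose_10 by (simp add: alt_sum_eq_evl upt_rec leg_def)

lemma alt_sum_10_9: "alt_sum y 10 9 = evl jac y"
  using choose_10 choose_9 by (simp add: alt_sum_eq_evl upt_rec jac_def binomial_eq_0)

lemma evl_replicate_0 [simp]: "evl (replicate n 0) x = 0"
  by (induction n) auto

lemma evl_diag:
  "evl diag r = (1 - r) * (1 - r) * evl leg (r * r) + 2 * r * (1 + r - r * r + r * r * r) * evl jac (r * r)"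
proof -
  \<comment> \<open>\<open>pdbl\<close> and \<open>pmul\<close> keep trailing zeros, so the right
    side has 24 entries; padding makes the two lists literally equal.\<close>
  have "padd diag (replicate 24 0) = padd (pmul [1, -2, 1] (pdbl leg)) (pmul [0, 2, 2, -2, 2] (pdbl jac))"
    by code_simp
  from arg_cong[OF this, of "\<lambda>p. evl p r"] show ?thesis
    by (simp add: algebra_simps)
qed

section \<open>Isolating the zeros on the diagonal\<close>

lemma DERIV_pos_evl_less:
  assumes "pos_on L R d (pder p)" "of_int L / of_int d \<le> x" "x < y" "y < of_int R / of_int d"
  shows "evl p x < evl p y"
  using assms(3)
proof (rule DERIV_pos_imp_increasing)
  fix z assume "x \<le> z" "z \<le> y"
  then show "\<exists>m. (evl p has_real_derivative m) (at z) \<and> 0 < m"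
    using DERIV_evl pos_onD[OF assms(1), of z] assms(2,4) by fastforce
qed

text \<open>The outer interval certifies monotonicity, hence uniqueness and the signs on both sides;
  the inner bracket \<open>u\<close>, \<open>v\<close> locates the zero as precisely as
  needed.\<close>

lemma evl_sign_change:
  assumes der: "pos_on L R d (pder p)"
    and uv: "of_int L / of_int d \<le> u" "u < v" "v < of_int R / of_int d" "evl p u < 0" "0 < evl p v"
  obtains r where "u < r" "r < v" "evl p r = 0"
    "\<And>x. of_int L / of_int d \<le> x \<Longrightarrow> x < r \<Longrightarrow> evl p x < 0"
    "\<And>x. r < x \<Longrightarrow> x < of_int R / of_int d \<Longrightarrow> 0 < evl p x"
proof -
  have "\<exists>r. u \<le> r \<and> r \<le> v \<and> evl p r = 0"
    using uv by (intro IVT) (auto intro: DERIV_isCont[OF DERIV_evl])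
  then obtain r where r: "u \<le> r" "r \<le> v" "evl p r = 0"
    by blast
  with uv have "u < r" "r < v"
    by (metis less_irrefl order_le_less)+
  then show ?thesis
    using that r(3) DERIV_pos_evl_less[OF der, of _ r] DERIV_pos_evl_less[OF der, of r] uv by force
qed

text \<open>These zero-free intervals alternate with the monotonicity intervals of
  \<open>diag_slopes\<close>; together they cover \<open>[0, 1)\<close>.\<close>

lemma diag_signs:
  "pos_on 0 1 16 diag" "pos_on 2 4 16 (pscale (-1) diag)" "pos_on 5 7 16 diag"
  "pos_on 8 10 16 (pscale (-1) diag)" "pos_on 11 14 16 diag" "pos_on 15 16 16 (pscale (-1) diag)"
  by code_simp+

lemma diag_slopes:
  "pos_on 1 2 16 (pder (pscale (-1) diag))" "pos_on 4 5 16 (pder diag)"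
  "pos_on 7 8 16 (pder (pscale (-1) diag))" "pos_on 10 11 16 (pder diag)"
  "pos_on 14 15 16 (pder (pscale (-1) diag))"
  by code_simp+

lemma evl_diag_roots:
  obtains r1 r2 r3 r4 r5 :: real where
    "0.1164115 < r1" "r1 < 0.1164125" "0.2769335 < r2" "r2 < 0.2769345" "0.4569695 < r3" "r3 < 0.4569705"
    "0.6672555 < r4" "r4 < 0.6672565" "0.9264895 < r5" "r5 < 0.9264905"
    "\<And>r. r \<in> {r1, r2, r3, r4, r5} \<Longrightarrow> evl diag r = 0"
    "\<And>r. r \<in> {0..<r1} \<union> {r2<..<r3} \<union> {r4<..<r5} \<Longrightarrow> 0 < evl diag r"
    "\<And>r. r \<in> {r1<..<r2} \<union> {r3<..<r4} \<union> {r5<..<1} \<Longrightarrow> evl diag r < 0"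
proof -
  let ?n = "pscale (-1) diag"
  note p0 = diag_signs(1) and n1 = diag_signs(2) and p2 = diag_signs(3)
    and n3 = diag_signs(4) and p4 = diag_signs(5) and n5 = diag_signs(6)
    and d1 = diag_slopes(1) and d2 = diag_slopes(2) and d3 = diag_slopes(3)
    and d4 = diag_slopes(4) and d5 = diag_slopes(5)
  \<comment> \<open>Each bracket is 1 minus a claimed zero, give or take half a unit of the sixth
    decimal; \<open>r1\<close> belongs to the largest zero.\<close>
  obtain r1 where r1: "0.1164115 < r1" "r1 < 0.1164125" "evl ?n r1 = 0"
      "\<And>x. 1 / 16 \<le> x \<Longrightarrow> x < r1 \<Longrightarrow> evl ?n x < 0" "\<And>x. r1 < x \<Longrightarrow> x < 2 / 16 \<Longrightarrow> 0 < evl ?n x"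
    by (rule evl_sign_change[OF d1, of "0.1164115" "0.1164125"]) (simp_all add: diag_def)
  obtain r2 where r2: "0.2769335 < r2" "r2 < 0.2769345" "evl diag r2 = 0"
      "\<And>x. 4 / 16 \<le> x \<Longrightarrow> x < r2 \<Longrightarrow> evl diag x < 0" "\<And>x. r2 < x \<Longrightarrow> x < 5 / 16 \<Longrightarrow> 0 < evl diag x"
    by (rule evl_sign_change[OF d2, of "0.2769335" "0.2769345"]) (simp_all add: diag_def)
  obtain r3 where r3: "0.4569695 < r3" "r3 < 0.4569705" "evl ?n r3 = 0"
      "\<And>x. 7 / 16 \<le> x \<Longrightarrow> x < r3 \<Longrightarrow> evl ?n x < 0" "\<And>x. r3 < x \<Longrightarrow> x < 8 / 16 \<Longrightarrow> 0 < evl ?n x"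
    by (rule evl_sign_change[OF d3, of "0.4569695" "0.4569705"]) (simp_all add: diag_def)
  obtain r4 where r4: "0.6672555 < r4" "r4 < 0.6672565" "evl diag r4 = 0"
      "\<And>x. 10 / 16 \<le> x \<Longrightarrow> x < r4 \<Longrightarrow> evl diag x < 0" "\<And>x. r4 < x \<Longrightarrow> x < 11 / 16 \<Longrightarrow> 0 < evl diag x"
    by (rule evl_sign_change[OF d4, of "0.6672555" "0.6672565"]) (simp_all add: diag_def)
  obtain r5 where r5: "0.9264895 < r5" "r5 < 0.9264905" "evl ?n r5 = 0"
      "\<And>x. 14 / 16 \<le> x \<Longrightarrow> x < r5 \<Longrightarrow> evl ?n x < 0" "\<And>x. r5 < x \<Longrightarrow> x < 15 / 16 \<Longrightarrow> 0 < evl ?n x"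
    by (rule evl_sign_change[OF d5, of "0.9264895" "0.9264905"]) (simp_all add: diag_def)
  have pos: "0 < evl diag r" if r: "r \<in> {0..<r1} \<union> {r2<..<r3} \<union> {r4<..<r5}" for r
  proof -
    consider "0 \<le> r" "r < r1" | "r2 < r" "r < r3" | "r4 < r" "r < r5"
      using r by auto
    then show ?thesis
    proof cases
      case 1
      then show ?thesis
        using pos_onD[OF p0, of r] r1(4)[of r] by (cases "r < 1 / 16") simp_all
    next
      case 2
      then show ?thesis
        using r2(5)[of r] pos_onD[OF p2, of r] r3(4)[of r]
        by (cases "r < 5 / 16"; cases "r < 7 / 16") simp_all
    next
      case 3
      then show ?thesis
        using r4(5)[of r] pos_onD[OF p4, of r] r5(4)[of r]
        by (cases "r < 11 / 16"; cases "r < 14 / 16") simp_all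
    qed
  qed
  have neg: "evl diag r < 0" if r: "r \<in> {r1<..<r2} \<union> {r3<..<r4} \<union> {r5<..<1}" for r
  proof -
    consider "r1 < r" "r < r2" | "r3 < r" "r < r4" | "r5 < r" "r < 1"
      using r by auto
    then show ?thesis
    proof cases
      case 1
      then show ?thesis
        using r1(5)[of r] pos_onD[OF n1, of r] r2(4)[of r]
        by (cases "r < 2 / 16"; cases "r < 4 / 16") simp_all
    next
      case 2
      then show ?thesis
        using r3(5)[of r] pos_onD[OF n3, of r] r4(4)[of r]
        by (cases "r < 8 / 16"; cases "r < 10 / 16") simp_all
    next
      case 3
      then show ?thesis
        using r5(5)[of r] pos_onD[OF n5, of r] by (cases "r < 15 / 16") simp_all
    qed
  qed
  show ?thesis
    by (rule that[OF r1(1,2) r2(1,2) r3(1,2) r4(1,2) r5(1,2)])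
      (use r1(3) r2(3) r3(3) r4(3) r5(3) pos neg in auto)
qed

section \<open>The game to 11\<close>

text \<open>The factor of the closed form that decides the sign, in the probabilities
  \<open>A\<close>, \<open>B\<close> that the serving team loses a rally.\<close>

definition discr :: "real \<Rightarrow> real \<Rightarrow> real" where
  "discr A B = (1 - A) * (1 - B) * evl leg (A * B) +
    ((A + B) * (1 - A * B) + 2 * (A * B) * (1 + A * B)) * evl jac (A * B)"

lemma sgn_advantage_11:
  assumes "0 < pA" "pA < 1" "0 < pB" "pB < 1"
  shows "sgn (advantage 11 pA pB) = sgn (discr (1 - pA) (1 - pB))"
proof -
  define y where "y = (1 - pA) * (1 - pB)"
  have "(1 - pA) * (1 - pB) < 1 * 1"
    using assms by (intro mult_strict_mono) auto
  then have y: "0 < y" "y < 1"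
    using assms by (auto simp: y_def)
  define G where "G = ((1 - y) * (1 + y)\<^sup>2 + pA * pB * y * (3 - y)) * (1 + y) ^ 20"
  have "advantage 11 pA pB * G = (pA * pB) ^ 11 * discr (1 - pA) (1 - pB)"
    using advantage_formula[of 11 pA pB] assms
    by (simp add: G_def y_def discr_def alt_sum_10_10 alt_sum_10_9 mult.assoc)
  then have "sgn (advantage 11 pA pB) * sgn G = sgn ((pA * pB) ^ 11) * sgn (discr (1 - pA) (1 - pB))"
    by (metis sgn_mult)
  moreover have "sgn G = 1"
    using y assms unfolding G_def sgn_1_pos
    by (intro mult_pos_pos add_pos_pos zero_less_power) auto
  moreover have "sgn ((pA * pB) ^ 11) = 1"
    using assms unfolding sgn_1_pos by (intro zero_less_power mult_pos_pos)
  ultimately show ?thesis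
    by simp
qed

lemma discr_diag: "discr r r = evl diag r"
  by (simp add: discr_def evl_diag algebra_simps)

lemma round_dec_6_eqI:
  assumes "\<bar>10 ^ 6 * x - of_int m\<bar> < 1 / 2"
  shows "round_dec 6 x = of_int m / 10 ^ 6"
  unfolding round_dec_def using round_unique'[OF assms] by simp

text \<open>With \<open>A * B\<close> fixed, \<open>discr A B / ((1 - A) * (1 - B))\<close> moves away from its value on the diagonal
  in the direction of the sign of \<open>jac\<close>.\<close>

lemma discr_neg_if_diag_neg:
  assumes AB: "0 < A" "A < 1" "0 < B" "B < 1"
    and jac: "evl jac (A * B) \<le> 0" and diag: "evl diag (sqrt (A * B)) < 0"
  shows "discr A B < 0"
proof -
  define r where "r = sqrt (A * B)"
  define y where "y = A * B"
  have "A * B < 1 * 1"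
    using AB by (intro mult_strict_mono) auto
  then have y: "0 < y" "y < 1"
    using AB by (auto simp: y_def)
  have r: "r * r = y" "0 < r" "r < 1"
    using y by (auto simp: r_def y_def)
  have s: "2 * r \<le> A + B"
    using arith_geo_mean_sqrt[of A B] AB by (simp add: r_def)
  define p p0 n n0 where "p = (1 - A) * (1 - B)" and "p0 = (1 - r) * (1 - r)"
    and "n = (A + B) * (1 - y) + 2 * y * (1 + y)" and "n0 = 2 * r * (1 - y) + 2 * y * (1 + y)"
  have pos: "0 < p" "0 < p0" "0 \<le> n"
    using AB y r(3) by (auto simp: p_def p0_def n_def)
  have "p \<le> p0"
    using s r(1) by (simp add: p_def p0_def y_def algebra_simps)
  moreover have "n0 \<le> n"
    using s y mult_right_mono[OF s, of "1 - y"] by (simp add: n_def n0_def)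
  \<comment> \<open>This is \<open>n0 / p0 \<le> n / p\<close> cross-multiplied: the ratio is
    smallest on the diagonal, by the arithmetic-geometric mean inequality \<open>s\<close>.\<close>
  ultimately have "n0 * p \<le> n * p0"
    using pos by (intro mult_mono) auto
  have "p0 * discr A B = p0 * p * evl leg y + (n * p0) * evl jac y"
    by (simp add: discr_def p_def n_def y_def algebra_simps)
  also have "\<dots> \<le> p0 * p * evl leg y + (n0 * p) * evl jac y"
    using \<open>n0 * p \<le> n * p0\<close> jac by (simp add: y_def mult_right_mono_neg)
  also have "\<dots> = p * evl diag r"
    unfolding discr_diag[symmetric] discr_def r(1) by (simp add: p0_def n0_def algebra_simps)
  also have "\<dots> < 0"
    using pos diag by (simp add: r_def mult_pos_neg)
  finally show ?thesis
    using pos by (simp add: mult_less_0_iff)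
qed

text \<open>\<open>12 / 56 = 3 / 14\<close> is where the corner region ends, and
  \<open>25 / 56\<close> lies just above the square of \<open>r4\<close>.\<close>

lemma jac_neg: "12 / 56 \<le> y \<Longrightarrow> y < 25 / 56 \<Longrightarrow> evl jac y < 0"
proof -
  assume y: "12 / 56 \<le> y" "y < 25 / 56"
  have "pos_on 12 25 56 (pscale (-1) jac)"
    by code_simp
  from pos_onD[OF this, of y] y show ?thesis
    by simp
qed

text \<open>The window \<open>[14 / 70, 15 / 70)\<close> contains the square of \<open>r3\<close>.
  The crude bounds suffice because \<open>jac\<close> falls there with slope below -25.\<close>

lemma jac_leg_bounds:
  assumes "1 / 5 \<le> y" "y < 3 / 14"
  shows "evl jac y < 1" "- 1 < evl leg y" "evl (pder jac) y < - 25" "evl (pder leg) y < 0"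
proof -
  have c: "pos_on 14 15 70 (padd [1] (pscale (-1) jac))" "pos_on 14 15 70 (padd [1] leg)"
    "pos_on 14 15 70 (padd [-25] (pscale (-1) (pder jac)))" "pos_on 14 15 70 (pscale (-1) (pder leg))"
    by code_simp+
  show "evl jac y < 1" "- 1 < evl leg y" "evl (pder jac) y < - 25" "evl (pder leg) y < 0"
    using pos_onD[OF c(1), of y] pos_onD[OF c(2), of y] pos_onD[OF c(3), of y] pos_onD[OF c(4), of y] assms
    by simp_all
qed

lemma jac_leg_slopes:
  assumes "1 / 5 \<le> y0" "y0 \<le> y" "y < 3 / 14"
  shows "evl jac y \<le> evl jac y0 - 25 * (y - y0)" "evl leg y \<le> evl leg y0"
proof -
  have "evl jac y + 25 * y \<le> evl jac y0 + 25 * y0"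
  proof (rule DERIV_nonpos_imp_nonincreasing[OF assms(2)])
    fix x assume x: "y0 \<le> x" "x \<le> y"
    have "((\<lambda>x. evl jac x + 25 * x) has_real_derivative evl (pder jac) x + 25 * 1) (at x)"
      by (intro DERIV_add DERIV_evl DERIV_cmult DERIV_ident)
    then show "\<exists>d. ((\<lambda>x. evl jac x + 25 * x) has_real_derivative d) (at x) \<and> d \<le> 0"
      using jac_leg_bounds(3)[of x] assms x by (intro exI conjI) auto
  qed
  then show "evl jac y \<le> evl jac y0 - 25 * (y - y0)"
    by simp
  show "evl leg y \<le> evl leg y0"
  proof (rule DERIV_nonpos_imp_nonincreasing[OF assms(2)])
    fix x assume x: "y0 \<le> x" "x \<le> y"
    then show "\<exists>d. (evl leg has_real_derivative d) (at x) \<and> d \<le> 0"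
      using jac_leg_bounds(4)[of x] assms DERIV_evl by (intro exI[of _ "evl (pder leg) x"]) auto
  qed
qed

text \<open>Moving away from the corner \<open>(q, q)\<close>, the decrease of \<open>jac\<close> outweighs all other changes.\<close>

lemma discr_neg_near_corner:
  assumes q: "0.456 < q" "q < 0.458" "evl diag q = 0"
    and AB: "q < A" "A < 1" "q < B" "B < 1" and small: "A * B < 3 / 14" and jac: "0 \<le> evl jac (A * B)"
  shows "discr A B < 0"
proof -
  define y y0 where "y = A * B" and "y0 = q * q"
  define \<Delta> where "\<Delta> = y - y0"
  have "y0 < y"
    unfolding y_def y0_def using q AB by (intro mult_strict_mono) auto
  then have \<Delta>: "0 < \<Delta>"
    by (simp add: \<Delta>_def)
  have "0.456 * 0.456 \<le> y0"
    unfolding y0_def using q by (intro mult_mono) auto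
  then have y0: "1 / 5 \<le> y0"
    by simp
  have y: "y < 3 / 14"
    using small by (simp add: y_def)
  define s where "s = A + B - 2 * q"
  have s: "0 < s"
    using AB by (simp add: s_def)
  have "\<Delta> = q * s + (A - q) * (B - q)"
    by (simp add: \<Delta>_def y_def y0_def s_def algebra_simps)
  moreover have "0 < (A - q) * (B - q)"
    using AB by simp
  moreover have "0.456 * s \<le> q * s"
    using q s by (intro mult_right_mono) auto
  ultimately have "0.456 * s \<le> \<Delta>"
    by linarith
  \<comment> \<open>\<open>1 / 0.456 < 2.2\<close>.\<close>
  then have s_le: "s \<le> 2.2 * \<Delta>"
    using s by simp
  define p p0 n n0 where "p = (1 - A) * (1 - B)" and "p0 = (1 - q) * (1 - q)"
    and "n = (A + B) * (1 - y) + 2 * y * (1 + y)" and "n0 = (q + q) * (1 - y0) + 2 * y0 * (1 + y0)"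
  have p: "0 < p" "p \<le> p0" "p0 - p \<le> 2.2 * \<Delta>"
  proof -
    show "0 < p"
      using AB by (simp add: p_def)
    show "p \<le> p0"
      unfolding p_def p0_def using AB q by (intro mult_mono) auto
    have "p0 - p = s - \<Delta>"
      by (simp add: p_def p0_def s_def \<Delta>_def y_def y0_def algebra_simps)
    then show "p0 - p \<le> 2.2 * \<Delta>"
      using s_le \<Delta> by simp
  qed
  have n: "0.7 \<le> n" "n - n0 \<le> 6 * \<Delta>"
  proof -
    \<comment> \<open>From \<open>A + B > 2 * 0.456\<close> and
      \<open>1 - y > 11 / 14\<close>.\<close>
    have "0.9 * 0.78 \<le> (A + B) * (1 - y)"
      using AB q y by (intro mult_mono) auto
    moreover have "0 < y * (1 + y)"
      using y0 \<open>y0 < y\<close> by simp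
    ultimately show "0.7 \<le> n"
      by (simp add: n_def)
    have "n - n0 = s * (1 - y) + \<Delta> * (2 * (1 + y + y0) - 2 * q)"
      by (simp add: n_def n0_def s_def \<Delta>_def algebra_simps)
    also have "\<dots> \<le> s * 1 + \<Delta> * 3"
      using s \<Delta> y y0 q \<open>y0 < y\<close> by (intro add_mono mult_left_mono) auto
    finally show "n - n0 \<le> 6 * \<Delta>"
      using s_le \<Delta> by simp
  qed
  have slopes: "evl jac y \<le> evl jac y0 - 25 * \<Delta>" "evl leg y \<le> evl leg y0"
    unfolding \<Delta>_def using jac_leg_slopes[OF y0 _ y] \<open>y0 < y\<close> by simp_all
  have bounds: "evl jac y0 < 1" "- 1 < evl leg y0" "0 \<le> evl jac y0"
    using jac_leg_bounds(1,2)[OF y0] \<open>y0 < y\<close> y slopes(1) jac \<Delta> by (simp_all add: y_def)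
  have zero: "p0 * evl leg y0 + n0 * evl jac y0 = 0"
    using q(3) by (simp add: discr_diag[symmetric] discr_def p0_def n0_def y0_def algebra_simps)
  have "discr A B = p * evl leg y + n * evl jac y"
    by (simp add: discr_def p_def n_def y_def mult.assoc)
  also have "\<dots> \<le> p * evl leg y0 + n * (evl jac y0 - 25 * \<Delta>)"
    using slopes p n by (intro add_mono mult_left_mono) auto
  also have "\<dots> = (p0 - p) * (- evl leg y0) + (n - n0) * evl jac y0 - 25 * n * \<Delta>"
    using zero by (simp add: algebra_simps)
  \<comment> \<open>Per unit of \<open>\<Delta>\<close>, gains of at most \<open>2.2 + 6\<close>
    face a loss of \<open>25 * 0.7 = 17.5\<close>.\<close>
  also have "\<dots> \<le> (p0 - p) * 1 + (6 * \<Delta>) * 1 - 25 * 0.7 * \<Delta>"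
    using p n bounds \<Delta>
    by (intro diff_mono add_mono mult_left_mono mult_right_mono mult_mono) auto
  also have "\<dots> < 0"
    using p(3) \<Delta> by simp
  finally show ?thesis .
qed

theorem mainTheorem2:
  shows "\<exists>x1 x2 x3 x4 x5 :: real.
    x1 < x2 \<and> x2 < x3 \<and> x3 < x4 \<and> x4 < x5 \<and>
    {x \<in> {0<..<1}. advantage 11 x x = 0} = {x1, x2, x3, x4, x5} \<and>
    round_dec 6 x1 = 0.073510 \<and> round_dec 6 x2 = 0.332744 \<and> round_dec 6 x3 = 0.543030 \<and>
    round_dec 6 x4 = 0.723066 \<and> round_dec 6 x5 = 0.883588 \<and>
    (\<forall>x \<in> {0<..<x1} \<union> {x2<..<x3} \<union> {x4<..<x5}. advantage 11 x x < 0) \<and>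
    (\<forall>x \<in> {x1<..<x2} \<union> {x3<..<x4} \<union> {x5<..<1}. advantage 11 x x > 0) \<and>
    (\<forall>pA \<in> {x2<..<x3}. \<forall>pB \<in> {x2<..<x3}. advantage 11 pA pB < 0)"
proof (rule evl_diag_roots)
  fix r1 r2 r3 r4 r5 :: real
  assume r:
    "0.1164115 < r1" "r1 < 0.1164125" "0.2769335 < r2" "r2 < 0.2769345" "0.4569695 < r3" "r3 < 0.4569705"
    "0.6672555 < r4" "r4 < 0.6672565" "0.9264895 < r5" "r5 < 0.9264905"
    and zero: "\<And>r. r \<in> {r1, r2, r3, r4, r5} \<Longrightarrow> evl diag r = 0"
    and pos: "\<And>r. r \<in> {0..<r1} \<union> {r2<..<r3} \<union> {r4<..<r5} \<Longrightarrow> 0 < evl diag r"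
    and neg: "\<And>r. r \<in> {r1<..<r2} \<union> {r3<..<r4} \<union> {r5<..<1} \<Longrightarrow> evl diag r < 0"
  \<comment> \<open>The zeros sought are \<open>1 - r\<close>, so the order of the roots and of the
    intervals is reversed from here on.\<close>
  have sgn: "sgn (advantage 11 x x) = sgn (evl diag (1 - x))" if "x \<in> {0<..<1}" for x
    using that sgn_advantage_11[of x x] by (simp add: discr_diag)
  have neg': "advantage 11 x x < 0" if "x \<in> {0<..<1 - r5} \<union> {1 - r4<..<1 - r3} \<union> {1 - r2<..<1 - r1}" for x
  proof -
    have "x \<in> {0<..<1}" "evl diag (1 - x) < 0"
      using that r by (auto intro!: neg)
    then show ?thesis
      using sgn[of x] by (metis sgn_less)
  qed
  have pos': "0 < advantage 11 x x" if "x \<in> {1 - r5<..<1 - r4} \<union> {1 - r3<..<1 - r2} \<union> {1 - r1<..<1}" for x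
  proof -
    have "x \<in> {0<..<1}" "0 < evl diag (1 - x)"
      using that r by (auto intro!: pos)
    then show ?thesis
      using sgn[of x] by (metis sgn_greater)
  qed
  have zero': "advantage 11 x x = 0" if "x \<in> {1 - r5, 1 - r4, 1 - r3, 1 - r2, 1 - r1}" for x
  proof -
    have "x \<in> {0<..<1}" "evl diag (1 - x) = 0"
      using that r by (auto intro!: zero)
    then show ?thesis
      using sgn[of x] by (metis sgn_0_0)
  qed
  have zeros: "{x \<in> {0<..<1}. advantage 11 x x = 0} = {1 - r5, 1 - r4, 1 - r3, 1 - r2, 1 - r1}" (is "?Z = ?R")
  proof (rule set_eqI, rule iffI)
    fix x assume x: "x \<in> ?Z"
    show "x \<in> ?R"
    proof (rule ccontr)
      assume "x \<notin> ?R"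
      then have "x \<in> {0<..<1 - r5} \<union> {1 - r4<..<1 - r3} \<union> {1 - r2<..<1 - r1} \<or>
          x \<in> {1 - r5<..<1 - r4} \<union> {1 - r3<..<1 - r2} \<union> {1 - r1<..<1}"
        using x by (auto simp: not_less)
      then show False
        using x neg'[of x] pos'[of x] by auto
    qed
  next
    fix x assume "x \<in> ?R"
    then show "x \<in> ?Z"
      using zero'[of x] r by auto
  qed
  have rounds: "round_dec 6 (1 - r5) = 0.073510" "round_dec 6 (1 - r4) = 0.332744"
    "round_dec 6 (1 - r3) = 0.543030" "round_dec 6 (1 - r2) = 0.723066" "round_dec 6 (1 - r1) = 0.883588"
    using r round_dec_6_eqI[of "1 - r5" 73510] round_dec_6_eqI[of "1 - r4" 332744]
      round_dec_6_eqI[of "1 - r3" 543030] round_dec_6_eqI[of "1 - r2" 723066] round_dec_6_eqI[of "1 - r1" 883588]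
    by (simp_all add: abs_if)
  have square: "advantage 11 pA pB < 0" if "pA \<in> {1 - r4<..<1 - r3}" "pB \<in> {1 - r4<..<1 - r3}" for pA pB
  proof -
    define A B where "A = 1 - pA" and "B = 1 - pB"
    have AB: "r3 < A" "A < r4" "r3 < B" "B < r4"
      using that by (auto simp: A_def B_def)
    have AB1: "0 < A" "A < 1" "0 < B" "B < 1"
      using AB r by auto
    have "discr A B < 0"
    proof (cases "A * B < 3 / 14 \<and> 0 \<le> evl jac (A * B)")
      case True
      then show ?thesis
        using AB AB1 r zero[of r3] by (intro discr_neg_near_corner[of r3]) auto
    next
      \<comment> \<open>If \<open>jac\<close> is not already negative then
        \<open>A * B \<ge> 3 / 14\<close>, so \<open>jac_neg\<close> applies. The geometric mean of
        \<open>A\<close> and \<open>B\<close> lies between \<open>r3\<close> and \<open>r4\<close>,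
        where \<open>diag\<close> is negative.\<close>
      case False
      have "A * B < 0.6672565 * 0.6672565"
        using AB AB1 r by (intro mult_strict_mono) auto
      then have "A * B < 25 / 56"
        by simp
      then have "evl jac (A * B) \<le> 0"
        using False jac_neg[of "A * B"] by force
      moreover have "r3 < sqrt (A * B)"
      proof (rule real_less_rsqrt)
        show "r3\<^sup>2 < A * B"
          unfolding power2_eq_square using AB r by (intro mult_strict_mono) auto
      qed
      moreover have "sqrt (A * B) < r4"
      proof (rule real_less_lsqrt)
        show "A * B < r4\<^sup>2"
          unfolding power2_eq_square using AB AB1 r by (intro mult_strict_mono) auto
      qed (use r in auto)
      ultimately show ?thesis
        using AB1 by (intro discr_neg_if_diag_neg neg) auto
    qed
    moreover have "sgn (advantage 11 pA pB) = sgn (discr A B)"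
      unfolding A_def B_def using AB1 by (intro sgn_advantage_11) (auto simp: A_def B_def)
    ultimately show ?thesis
      by (metis sgn_less)
  qed
  show ?thesis
  proof (rule exI[of _ "1 - r5"], rule exI[of _ "1 - r4"], rule exI[of _ "1 - r3"],
      rule exI[of _ "1 - r2"], rule exI[of _ "1 - r1"], intro conjI ballI)
    show "1 - r5 < 1 - r4" "1 - r4 < 1 - r3" "1 - r3 < 1 - r2" "1 - r2 < 1 - r1"
      using r by simp_all
  qed (fact zeros rounds neg' pos' square)+
qed

end
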